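(* Let $\Gamma\subset\mathbb{Z}^m$ ($m\le n$), let $\Phi:\Gamma\to\mathrm{Spin}(\mathbb{R}^{n+2}_1)$ satisfy $\Phi(t+t_j)=e_js_j(t+\frac12t_j)\cdot\Phi(t)$, $1\le j\le m$, with vector functions $s_j:\Gamma_j\to S^{n+1}_1$, and put $F:=\Phi^{-1}e_0\Phi$, $\hat F:=\Phi^{-1}e_\infty\Phi:\Gamma\to L^{n+1}$. (1) The two nets $F,\hat F$ in the conformal $n$-sphere envelope a discrete Ribaucour sphere congruence $$S=\Phi^{-1}\,\big(e_0\wedge s_1\wedge\dots\wedge s_m\wedge e_\infty\big)\,\Phi:\Gamma^*\to\Lambda^{m+2}\cong\Lambda^{n-m},$$ i.e. all corresponding elementary $m$-cells of the two nets $F$ and $\hat F$ lie on the $m$-spheres $S(t+\frac12(1,\dots,1))$. Here the spheres $S$ depend only on the elementary $m$-cells of $\Gamma$, i.e. the domain of $S$ is the dual lattice $\Gamma^*$; at the cell with vertices $t+\sum_i\varepsilon_it_i$, $\varepsilon_i\in\{0,1\}$, the formula is evaluated with $\Phi=\Phi(t)$ and $s_j=s_j(t+\frac12t_j)$. (2) Moreover, the nets $F,\hat F$ form a (discrete) Ribaucour pair of orthogonal nets, i.e. all corresponding elementary $k$-cells of $F$ and $\hat F$, $1\le k\le m$, lie on $k$-spheres, and the points of corresponding $1$-cells (edges) do not separate on the circles they lie on: the point pairs $(F(t),F(t+t_j))$ and $(\hat F(t),\hat F(t+t_j))$ do not separate each other.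
   Context: $\mathbb{R}^{n+2}_1$ is Minkowski space with Lorentz product $\langle\cdot,\cdot\rangle$; products are taken in its Clifford algebra, with $vw+wv=-2\langle v,w\rangle$, which as a vector space is identified with the Grassmann algebra $\bigoplus_k\Lambda^k$. $(e_0,e_1,\dots,e_n,e_\infty)$ is a pseudo-orthonormal basis: $-e_i^2=e_0e_\infty+e_\infty e_0=1$ for $1\le i\le n$, $e_0^2=e_\infty^2=0$, and all other pairs of distinct basis vectors anticommute. $L^{n+1}=\{v:\langle v,v\rangle=0\}$ is the light cone, $S^{n+1}_1=\{v:\langle v,v\rangle=1\}$, $\mathrm{Spin}(\mathbb{R}^{n+2}_1)=\{\prod_{j=1}^{2r}\sigma_j:\sigma_j\in S^{n+1}_1\}$. Points of the conformal $n$-sphere are the null lines in $\mathbb{R}^{n+2}_1$; a pure timelike $(k+2)$-vector $v_1\wedge\dots\wedge v_{k+2}$ represents the $k$-sphere of null lines in $\mathrm{span}\{v_1,\dots,v_{k+2}\}$ (a $1$-sphere is a circle). The identification $\Lambda^{m+2}\cong\Lambda^{n-m}$ is multiplication by a fixed volume element of $\Lambda^{n+2}$ (Hodge duality up to sign). $t_j$ is the $j$-th standard basis vector of $\mathbb{Z}^m$; $t+\frac12t_j$ denotes the edge from $t$ to $t+t_j$, and $\Gamma_j$ is the lattice of these edges of $\Gamma$. An elementary $k$-cell of $\Gamma$ is a set $\{t+\sum_{l=1}^k\varepsilon_lt_{i_l}:\varepsilon_l\in\{0,1\}\}\subset\Gamma$ with $i_1<\dots<i_k$; elementary $k$-cells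 of $F$ and $\hat F$ are the images of such sets, and they correspond if they come from the same set. The cells "lie on" a sphere if their vertices do. The "i.e." clauses serve as definitions of the terms "discrete Ribaucour sphere congruence with envelopes $F,\hat F$" (where $F$ and $\hat F$ are discrete curvature line nets: the vertices of each elementary $2$-cell have real cross ratio) and "Ribaucour pair of orthogonal nets".
   Formalization: For m≥3 it is assumed that s_i≠±s_j at the lowest vertex of each elementary 2-cell of Γ (otherwise a 3-cell pair can span all of R^6 when n=4), and part (1) is claimed only for m-cells where S≠0, since a vanishing S represents no sphere. *)

theory Defs
  imports "HOL-Analysis.Analysis" "HOL-Library.Countable" "HOL-Combinatorics.Permutations"
begin

section \<open>Minkowski space and its Clifford algebra\<close>

text \<open>With \<open>n = CARD('n)\<close>, the type below is the \<open>(n+2)\<close>-dimensional Minkowski space; the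
  coordinate \<open>None\<close> is the timelike one.\<close>

type_synonym 'n minkowski = "real ^ ('n option option)"

definition lorentz :: "'n::finite minkowski \<Rightarrow> 'n minkowski \<Rightarrow> real" where
  "lorentz v w = (\<Sum>i\<in>UNIV. (if i = None then - 1 else 1) * (v $ i) * (w $ i))"

definition light_cone :: "'n::finite minkowski set" where
  "light_cone = {v. lorentz v v = 0}"

definition de_sitter :: "'n::finite minkowski set" where
  "de_sitter = {v. lorentz v v = 1}"

text \<open>An element of the Clifford algebra is given by its coefficients with respect to the ordered
  products \<open>b\<^sub>A\<close> (\<open>A\<close> a set of indices) of the standard orthonormal basis vectors; the order of the
  indices is the one induced by \<^const>\<open>to_nat\<close>.  One has \<open>b\<^sub>i\<^sup>2 = clifford_square i\<close> and
  \<open>b\<^sub>A b\<^sub>B = clifford_sign A B \<cdot> b\<^sub>C\<close>, where \<open>C\<close> is the symmetric difference of \<open>A\<close> and \<open>B\<close>.\<close>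

typedef 'n clifford = "UNIV :: ('n option option set \<Rightarrow> real) set"
  morphisms blade_coeff Clifford by simp

definition clifford_square :: "'n option option \<Rightarrow> real" where
  "clifford_square i = (if i = None then 1 else - 1)"

definition pair_sign :: "'n::finite option option \<Rightarrow> 'n option option \<Rightarrow> real" where
  "pair_sign a b =
     (if to_nat b < to_nat a then - 1 else if a = b then clifford_square a else 1)"

definition clifford_sign :: "'n::finite option option set \<Rightarrow> 'n option option set \<Rightarrow> real" where
  "clifford_sign A B = (\<Prod>a\<in>A. \<Prod>b\<in>B. pair_sign a b)"

definition sym_diff_set :: "'a set \<Rightarrow> 'a set \<Rightarrow> 'a set" where
  "sym_diff_set A B = (A - B) \<union> (B - A)"

lemma blade_coeff_Clifford [simp]: "blade_coeff (Clifford f) = f"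
  by (simp add: Clifford_inverse)

lemma clifford_eqI: "(\<And>A. blade_coeff x A = blade_coeff y A) \<Longrightarrow> x = y"
  by (simp add: fun_eq_iff flip: blade_coeff_inject)

lemma prod_sym_diff_set:
  fixes f :: "'a \<Rightarrow> real"
  assumes "finite A" "finite B" "\<And>a. f a * f a = 1"
  shows "prod f (sym_diff_set A B) = prod f A * prod f B"
proof -
  have A: "prod f A = prod f (A \<inter> B) * prod f (A - B)"
    by (rule prod.Int_Diff[OF assms(1)])
  have B: "prod f B = prod f (A \<inter> B) * prod f (B - A)"
    using prod.Int_Diff[OF assms(2), of f A] by (simp add: Int_commute)
  have I: "prod f (A \<inter> B) * prod f (A \<inter> B) = 1"
    by (simp add: assms(3) flip: prod.distrib)
  have "prod f (sym_diff_set A B) = prod f (A - B) * prod f (B - A)"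
    unfolding sym_diff_set_def using assms(1,2) by (intro prod.union_disjoint) auto
  moreover have "prod f A * prod f B
      = (prod f (A \<inter> B) * prod f (A \<inter> B)) * (prod f (A - B) * prod f (B - A))"
    unfolding A B by (simp only: mult_ac)
  ultimately show ?thesis using I by simp
qed

lemma prod_square_one:
  fixes g :: "'a \<Rightarrow> real"
  assumes "\<And>b. g b * g b = 1"
  shows "prod g C * prod g C = 1"
  by (simp add: assms flip: prod.distrib)

lemma pair_sign_square: "pair_sign a b * pair_sign a b = 1"
  by (simp add: pair_sign_def clifford_square_def)

lemma clifford_sign_sym_diff_right:
  "clifford_sign A (sym_diff_set B C) = clifford_sign A B * clifford_sign A C"
proof -
  have "prod (pair_sign a) (sym_diff_set B C) = prod (pair_sign a) B * prod (pair_sign a) C" for a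
    by (intro prod_sym_diff_set finite pair_sign_square)
  then show ?thesis
    by (simp add: clifford_sign_def prod.distrib)
qed

lemma clifford_sign_sym_diff_left:
  "clifford_sign (sym_diff_set A B) C = clifford_sign A C * clifford_sign B C"
  unfolding clifford_sign_def
  by (intro prod_sym_diff_set finite prod_square_one pair_sign_square)

lemma sym_diff_set_simps [simp]:
  "sym_diff_set A (sym_diff_set A B) = B" "sym_diff_set A A = {}"
  "sym_diff_set {} B = B" "sym_diff_set B {} = B"
  by (auto simp: sym_diff_set_def)

lemma sym_diff_set_assoc:
  "sym_diff_set (sym_diff_set A B) C = sym_diff_set A (sym_diff_set B C)"
  by (auto simp: sym_diff_set_def)

lemma clifford_sign_empty [simp]: "clifford_sign {} B = 1" "clifford_sign A {} = 1"
  by (auto simp: clifford_sign_def)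

lemma bij_sym_diff_set: "bij (sym_diff_set A)"
  by (rule o_bij[of "sym_diff_set A"]) auto

instantiation clifford :: (finite) real_algebra_1
begin

definition "0 = Clifford (\<lambda>_. 0)"
definition "1 = Clifford (\<lambda>A. if A = {} then 1 else 0)"
definition "x + y = Clifford (\<lambda>A. blade_coeff x A + blade_coeff y A)"
definition "x - y = Clifford (\<lambda>A. blade_coeff x A - blade_coeff y A)"
definition "- x = Clifford (\<lambda>A. - blade_coeff x A)"
definition "r *\<^sub>R x = Clifford (\<lambda>A. r * blade_coeff x A)"
definition "x * y = Clifford (\<lambda>C. \<Sum>A\<in>UNIV.
  clifford_sign A (sym_diff_set A C) * blade_coeff x A * blade_coeff y (sym_diff_set A C))"

instance
proof
  fix x y z :: "'a clifford" and r q :: real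
  show "x * y * z = x * (y * z)"
  proof (rule clifford_eqI)
    fix C
    let ?s = "sym_diff_set :: 'a option option set \<Rightarrow> _"
    have "blade_coeff (x * (y * z)) C = (\<Sum>A\<in>UNIV. \<Sum>B\<in>UNIV. clifford_sign A (?s A C) * blade_coeff x A *
        (clifford_sign B (?s B (?s A C)) * blade_coeff y B * blade_coeff z (?s B (?s A C))))"
      by (simp add: times_clifford_def sum_distrib_left)
    also have "\<dots> = (\<Sum>A\<in>UNIV. \<Sum>D\<in>UNIV. clifford_sign A (?s A C) * blade_coeff x A *
        (clifford_sign (?s A D) (?s D C) * blade_coeff y (?s A D) * blade_coeff z (?s D C)))"
    proof (rule sum.cong[OF refl])
      fix A
      have e: "?s (?s A D) (?s A C) = ?s D C" for D by (auto simp: sym_diff_set_def)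
      show "(\<Sum>B\<in>UNIV. clifford_sign A (?s A C) * blade_coeff x A *
          (clifford_sign B (?s B (?s A C)) * blade_coeff y B * blade_coeff z (?s B (?s A C)))) =
          (\<Sum>D\<in>UNIV. clifford_sign A (?s A C) * blade_coeff x A *
          (clifford_sign (?s A D) (?s D C) * blade_coeff y (?s A D) * blade_coeff z (?s D C)))"
        by (subst sum.reindex_bij_betw[OF bij_sym_diff_set[of A], symmetric]) (simp add: e)
    qed
    also have "\<dots> = (\<Sum>A\<in>UNIV. \<Sum>D\<in>UNIV. clifford_sign D (?s D C) *
        (clifford_sign A (?s A D) * blade_coeff x A * blade_coeff y (?s A D)) * blade_coeff z (?s D C))"
    proof (intro sum.cong refl)
      fix A D
      have e1: "?s A C = ?s (?s A D) (?s D C)" by (auto simp: sym_diff_set_def)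
      have e2: "clifford_sign D (?s D C) = clifford_sign A (?s D C) * clifford_sign (?s A D) (?s D C)"
        using clifford_sign_sym_diff_left[of A "?s A D"] by simp
      show "clifford_sign A (?s A C) * blade_coeff x A *
          (clifford_sign (?s A D) (?s D C) * blade_coeff y (?s A D) * blade_coeff z (?s D C)) =
          clifford_sign D (?s D C) *
          (clifford_sign A (?s A D) * blade_coeff x A * blade_coeff y (?s A D)) * blade_coeff z (?s D C)"
        unfolding e1 clifford_sign_sym_diff_right[of A "?s A D"] e2 by (simp add: mult_ac)
    qed
    also have "\<dots> = blade_coeff (x * y * z) C"
      by (subst sum.swap) (simp add: times_clifford_def sum_distrib_left sum_distrib_right)
    finally show "blade_coeff (x * y * z) C = blade_coeff (x * (y * z)) C" by simp
  qed
  show "1 * x = x"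
  proof (rule clifford_eqI)
    fix C
    have "blade_coeff (1 * x) C = (\<Sum>A\<in>(UNIV :: 'a option option set set). if A = {} then blade_coeff x C else 0)"
      unfolding one_clifford_def times_clifford_def blade_coeff_Clifford by (intro sum.cong) auto
    then show "blade_coeff (1 * x) C = blade_coeff x C" by simp
  qed
  show "x * 1 = x"
  proof (rule clifford_eqI)
    fix C
    have "blade_coeff (x * 1) C = (\<Sum>A\<in>UNIV. if A = C then blade_coeff x C else 0)"
      unfolding one_clifford_def times_clifford_def blade_coeff_Clifford
      by (intro sum.cong) (auto simp: sym_diff_set_def)
    then show "blade_coeff (x * 1) C = blade_coeff x C" by simp
  qed
  show "(0::'a clifford) \<noteq> 1"
  proof
    assume "(0::'a clifford) = 1"
    then have "blade_coeff (0::'a clifford) {} = blade_coeff 1 {}" by (rule arg_cong)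
    then show False by (simp add: zero_clifford_def one_clifford_def)
  qed
  show "r *\<^sub>R x * y = r *\<^sub>R (x * y)" "x * r *\<^sub>R y = r *\<^sub>R (x * y)"
    by (rule clifford_eqI,
        simp add: times_clifford_def scaleR_clifford_def sum_distrib_left mult.assoc mult.left_commute)+
  show "(x + y) * z = x * z + y * z" "x * (y + z) = x * y + x * z"
    by (rule clifford_eqI,
        simp add: times_clifford_def plus_clifford_def distrib_left distrib_right sum.distrib)+
qed (rule clifford_eqI,
      simp add: zero_clifford_def plus_clifford_def minus_clifford_def
        uminus_clifford_def scaleR_clifford_def distrib_left distrib_right)+

end

definition cl :: "'n::finite minkowski \<Rightarrow> 'n clifford" where
  "cl v = Clifford (\<lambda>A. \<Sum>i\<in>UNIV. if A = {i} then v $ i else 0)"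

lemma blade_coeff_cl_singleton [simp]: "blade_coeff (cl v) {i} = v $ i"
  by (simp add: cl_def)

lemma blade_coeff_cl_nonsingleton: "(\<And>i. A \<noteq> {i}) \<Longrightarrow> blade_coeff (cl v) A = 0"
  by (simp add: cl_def)

lemma inj_cl: "inj cl"
  by (rule injI) (simp add: vec_eq_iff flip: blade_coeff_cl_singleton)

lemma blade_coeff_add: "blade_coeff (x + y) A = blade_coeff x A + blade_coeff y A"
  by (simp add: plus_clifford_def)

lemma blade_coeff_scaleR: "blade_coeff (r *\<^sub>R x) A = r * blade_coeff x A"
  by (simp add: scaleR_clifford_def)

lemma blade_coeff_cl_mult:
  "blade_coeff (cl v * cl w) C = (\<Sum>i\<in>UNIV. v $ i *
     (\<Sum>j\<in>UNIV. if sym_diff_set {i} C = {j} then clifford_sign {i} {j} * w $ j else 0))"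
proof -
  have "blade_coeff (cl v * cl w) C = (\<Sum>A\<in>range (\<lambda>i. {i}).
      clifford_sign A (sym_diff_set A C) * blade_coeff (cl v) A * blade_coeff (cl w) (sym_diff_set A C))"
    unfolding times_clifford_def blade_coeff_Clifford
    by (rule sum.mono_neutral_right) (auto simp: image_iff intro!: blade_coeff_cl_nonsingleton)
  also have "\<dots> = (\<Sum>i\<in>UNIV. clifford_sign {i} (sym_diff_set {i} C) * v $ i
      * blade_coeff (cl w) (sym_diff_set {i} C))"
    by (subst sum.reindex) (auto simp: inj_on_def)
  also have "\<dots> = (\<Sum>i\<in>UNIV. v $ i *
     (\<Sum>j\<in>UNIV. if sym_diff_set {i} C = {j} then clifford_sign {i} {j} * w $ j else 0))"
    by (rule sum.cong) (auto simp: cl_def sum_distrib_left intro!: sum.cong)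
  finally show ?thesis .
qed

lemma sym_diff_set_eq_iff: "sym_diff_set A C = B \<longleftrightarrow> C = sym_diff_set A B"
  by auto

lemma sym_diff_set_commute: "sym_diff_set A B = sym_diff_set B A"
  by (auto simp: sym_diff_set_def)

lemma clifford_relation: "cl v * cl w + cl w * cl v = of_real (- 2 * lorentz v w)"
proof (rule clifford_eqI)
  fix C :: "'a option option set"
  define h :: "'a option option \<Rightarrow> 'a option option \<Rightarrow> real" where
    "h i j = (if C = sym_diff_set {i} {j} then clifford_sign {i} {j} else 0)" for i j
  define d :: "'a option option \<Rightarrow> real" where
    "d i = (if C = {} then 2 * clifford_square i else 0)" for i
  have 1: "blade_coeff (cl v * cl w) C = (\<Sum>i\<in>UNIV. \<Sum>j\<in>UNIV. v $ i * w $ j * h i j)"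
    for v w
    unfolding blade_coeff_cl_mult sum_distrib_left sym_diff_set_eq_iff h_def
    by (intro sum.cong refl) simp
  have 2: "blade_coeff (cl w * cl v) C = (\<Sum>i\<in>UNIV. \<Sum>j\<in>UNIV. v $ i * w $ j * h j i)"
    unfolding 1 by (subst sum.swap) (simp add: mult.commute)
  have hs: "h i j + h j i = 0" if "i \<noteq> j" for i j
  proof -
    have "to_nat i \<noteq> to_nat j" using that by simp
    then have "pair_sign i j + pair_sign j i = 0"
      using that unfolding pair_sign_def by (auto dest: linorder_neqE_nat)
    moreover have "sym_diff_set {j} {i} = sym_diff_set {i} {j}" by (rule sym_diff_set_commute)
    ultimately show ?thesis
      unfolding h_def clifford_sign_def by auto
  qed
  have h: "h i j + h j i = (if i = j then d i else 0)" for i j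
  proof (cases "i = j")
    case True
    then show ?thesis by (simp add: h_def d_def clifford_sign_def pair_sign_def)
  next
    case False
    then show ?thesis using hs by simp
  qed
  have "blade_coeff (cl v * cl w + cl w * cl v) C
      = (\<Sum>i\<in>UNIV. \<Sum>j\<in>UNIV. v $ i * w $ j * (h i j + h j i))"
    unfolding blade_coeff_add 1[of v w] 2 by (simp only: sum.distrib distrib_left)
  also have "\<dots> = (\<Sum>i\<in>UNIV. v $ i * w $ i * d i)"
  proof (rule sum.cong[OF refl])
    fix i
    have "(\<Sum>j\<in>UNIV. v $ i * w $ j * (h i j + h j i))
        = (\<Sum>j\<in>UNIV. if j = i then v $ i * w $ i * d i else 0)"
      unfolding h by (intro sum.cong refl) simp
    then show "(\<Sum>j\<in>UNIV. v $ i * w $ j * (h i j + h j i)) = v $ i * w $ i * d i"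
      by simp
  qed
  also have "\<dots> = (if C = {} then - 2 * lorentz v w else 0)"
  proof (cases "C = {}")
    case True
    have "d i = - 2 * (if i = None then - 1 else 1)" for i
      unfolding d_def clifford_square_def if_P[OF True] by (rule if_split[THEN iffD2]) simp
    then have "v $ i * w $ i * d i = - 2 * ((if i = None then - 1 else 1) * v $ i * w $ i)" for i
      by (simp only: mult_ac)
    then show ?thesis
      unfolding lorentz_def sum_distrib_left if_P[OF True] by (intro sum.cong refl)
  next
    case False
    then show ?thesis by (simp add: d_def)
  qed
  also have "\<dots> = blade_coeff (of_real (- 2 * lorentz v w)) C"
    by (simp add: of_real_def one_clifford_def scaleR_clifford_def uminus_clifford_def)
  finally show "blade_coeff (cl v * cl w + cl w * cl v) C
      = blade_coeff (of_real (- 2 * lorentz v w)) C" .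
qed

definition clifford_inv :: "'n::finite clifford \<Rightarrow> 'n clifford" where
  "clifford_inv x = (THE y. x * y = 1 \<and> y * x = 1)"

definition Spin :: "'n::finite clifford set" where
  "Spin = {prod_list (map cl \<sigma>) | \<sigma>. even (length \<sigma>) \<and> set \<sigma> \<subseteq> de_sitter}"

definition grade_one :: "'n::finite clifford \<Rightarrow> 'n minkowski" where
  "grade_one x = (\<chi> i. blade_coeff x {i})"

lemma grade_one_cl [simp]: "grade_one (cl v) = v"
  by (simp add: grade_one_def vec_eq_iff)

text \<open>The Grassmann algebra is identified with the Clifford algebra by antisymmetrization; for
  pairwise orthogonal vectors the value below is their Clifford product.\<close>

definition wedge :: "'n::finite minkowski list \<Rightarrow> 'n clifford" where
  "wedge vs = (1 / fact (length vs)) *\<^sub>R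
     (\<Sum>p | p permutes {..<length vs}.
        of_int (sign p) * prod_list (map (\<lambda>i. cl (vs ! p i)) [0..<length vs]))"

text \<open>These relations force the \<open>n+2\<close> vectors to form a basis.\<close>

definition pseudo_orthonormal ::
  "'n::finite minkowski \<Rightarrow> (nat \<Rightarrow> 'n minkowski) \<Rightarrow> 'n minkowski \<Rightarrow> bool" where
  "pseudo_orthonormal e0 e einf \<longleftrightarrow>
     cl e0 * cl e0 = 0 \<and> cl einf * cl einf = 0 \<and> cl e0 * cl einf + cl einf * cl e0 = 1 \<and>
     (\<forall>i\<in>{1..CARD('n)}. - (cl (e i) * cl (e i)) = 1 \<and>
        cl (e i) * cl e0 = - (cl e0 * cl (e i)) \<and> cl (e i) * cl einf = - (cl einf * cl (e i)) \<and>
        (\<forall>j\<in>{1..CARD('n)}. i \<noteq> j \<longrightarrow> cl (e i) * cl (e j) = - (cl (e j) * cl (e i))))"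

section \<open>Spheres in the conformal sphere\<close>

definition point :: "'n::finite minkowski \<Rightarrow> 'n minkowski set" where
  "point v = span {v}"

definition points_in :: "'n::finite minkowski set \<Rightarrow> 'n minkowski set set" where
  "points_in U = {point v | v. v \<in> U \<and> v \<in> light_cone \<and> v \<noteq> 0}"

text \<open>\<open>represents_sphere k S Q\<close>: \<open>S\<close> is a pure timelike (hence nonzero) \<open>(k+2)\<close>-vector, and \<open>Q\<close> is the
  \<open>k\<close>-sphere, as a set of null lines, that it represents.  A nonzero pure vector is timelike iff the
  subspace it determines has Minkowski signature, i.e. contains a timelike vector.\<close>

definition represents_sphere ::
  "nat \<Rightarrow> 'n::finite clifford \<Rightarrow> 'n minkowski set set \<Rightarrow> bool" where
  "represents_sphere k S Q \<longleftrightarrow>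
     (\<exists>vs. length vs = k + 2 \<and> distinct vs \<and> independent (set vs) \<and>
        (\<exists>v\<in>span (set vs). lorentz v v < 0) \<and>
        S = wedge vs \<and> Q = points_in (span (set vs)))"

definition is_sphere :: "nat \<Rightarrow> 'n::finite minkowski set set \<Rightarrow> bool" where
  "is_sphere k Q \<longleftrightarrow> (\<exists>S. represents_sphere k S Q)"

text \<open>For a circle \<open>Q\<close> and distinct points \<open>a, b\<close> on it: \<open>c\<close> and \<open>d\<close> lie in different components
  of \<open>Q - {a, b}\<close>.  The topology is that of the projective space, so two null lines are
  in the same component iff suitable nonzero representatives are connected in the cone over
  \<open>Q - {a, b}\<close>.\<close>

definition separate_on :: "'n::finite minkowski set set \<Rightarrow> 'n minkowski set \<Rightarrow> 'n minkowski set \<Rightarrow>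
    'n minkowski set \<Rightarrow> 'n minkowski set \<Rightarrow> bool" where
  "separate_on Q a b c d \<longleftrightarrow>
     a \<in> Q \<and> b \<in> Q \<and> a \<noteq> b \<and> c \<in> Q - {a, b} \<and> d \<in> Q - {a, b} \<and>
     \<not> (\<exists>v\<in>c. \<exists>w\<in>d. connected_component (\<Union>(Q - {a, b}) - {0}) v w)"

text \<open>The cross ratio of four null lines, given by null vectors, in the order for which four points of
  the complex plane have \<open>(x\<^sub>1 - x\<^sub>2)(x\<^sub>3 - x\<^sub>4) / ((x\<^sub>2 - x\<^sub>3)(x\<^sub>4 - x\<^sub>1))\<close>.  It is
  \<open>(v\<^sub>1v\<^sub>2v\<^sub>3v\<^sub>4 + v\<^sub>4v\<^sub>3v\<^sub>2v\<^sub>1) / ((v\<^sub>1v\<^sub>4 + v\<^sub>4v\<^sub>1)(v\<^sub>2v\<^sub>3 + v\<^sub>3v\<^sub>2))\<close>, whose denominator is a scalar.  It does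
  not depend on the scaling of the vectors and has a scalar part and a \<open>4\<close>-vector part; normalized,
  the latter squares to \<open>-1\<close> and is the imaginary unit of the \<open>2\<close>-sphere through the points.  If
  \<open>v\<^sub>1, v\<^sub>4\<close> or \<open>v\<^sub>2, v\<^sub>3\<close> represent the same point, the value is \<open>0\<close> by the convention for
  division, hence real; such four points are always concircular.\<close>

definition cross_ratio :: "'n::finite minkowski \<Rightarrow> 'n minkowski \<Rightarrow> 'n minkowski \<Rightarrow> 'n minkowski
    \<Rightarrow> 'n clifford" where
  "cross_ratio v1 v2 v3 v4 = (1 / (4 * lorentz v1 v4 * lorentz v2 v3)) *\<^sub>R
     (cl v1 * cl v2 * cl v3 * cl v4 + cl v4 * cl v3 * cl v2 * cl v1)"

section \<open>Nets\<close>

definition int_lattice :: "nat \<Rightarrow> (nat \<Rightarrow> int) set" where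
  "int_lattice m = {t. \<forall>i. i \<notin> {1..m} \<longrightarrow> t i = 0}"

text \<open>\<open>vertex t J\<close> is \<open>t + \<Sum>\<^bsub>j\<in>J\<^esub> t\<^sub>j\<close>; the cell at \<open>t\<close> in the directions \<open>I\<close>
  consists of the points \<open>vertex t J\<close> with \<open>J \<subseteq> I\<close>.\<close>

definition vertex :: "(nat \<Rightarrow> int) \<Rightarrow> nat set \<Rightarrow> nat \<Rightarrow> int" where
  "vertex t J = (\<lambda>i. t i + of_bool (i \<in> J))"

definition cell :: "(nat \<Rightarrow> int) \<Rightarrow> nat set \<Rightarrow> (nat \<Rightarrow> int) set" where
  "cell t I = vertex t ` Pow I"

definition elementary_cell ::
  "nat \<Rightarrow> (nat \<Rightarrow> int) set \<Rightarrow> nat \<Rightarrow> (nat \<Rightarrow> int) \<Rightarrow> nat set \<Rightarrow> bool" where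
  "elementary_cell m \<Gamma> k t I \<longleftrightarrow> I \<subseteq> {1..m} \<and> card I = k \<and> cell t I \<subseteq> \<Gamma>"

definition cells_on ::
  "((nat \<Rightarrow> int) \<Rightarrow> 'n::finite minkowski) \<Rightarrow> ((nat \<Rightarrow> int) \<Rightarrow> 'n minkowski) \<Rightarrow>
   (nat \<Rightarrow> int) set \<Rightarrow> 'n minkowski set set \<Rightarrow> bool" where
  "cells_on F Fh c Q \<longleftrightarrow> (\<forall>u\<in>c. point (F u) \<in> Q \<and> point (Fh u) \<in> Q)"

definition curvature_line_net ::
  "nat \<Rightarrow> (nat \<Rightarrow> int) set \<Rightarrow> ((nat \<Rightarrow> int) \<Rightarrow> 'n::finite minkowski) \<Rightarrow> bool" where
  "curvature_line_net m \<Gamma> F \<longleftrightarrow>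
     (\<forall>t i j. i \<noteq> j \<and> elementary_cell m \<Gamma> 2 t {i, j} \<longrightarrow>
        cross_ratio (F t) (F (vertex t {i})) (F (vertex t {i, j})) (F (vertex t {j})) \<in> \<real>)"

text \<open>The \<open>m\<close>-cell with lowest vertex \<open>t\<close> is referred to by \<open>t\<close>; \<open>D\<close> is the domain of \<open>S\<close>.\<close>

definition ribaucour_congruence ::
  "nat \<Rightarrow> (nat \<Rightarrow> int) set \<Rightarrow> (nat \<Rightarrow> int) set \<Rightarrow> ((nat \<Rightarrow> int) \<Rightarrow> 'n::finite clifford) \<Rightarrow>
   ((nat \<Rightarrow> int) \<Rightarrow> 'n minkowski) \<Rightarrow> ((nat \<Rightarrow> int) \<Rightarrow> 'n minkowski) \<Rightarrow> bool" where
  "ribaucour_congruence m \<Gamma> D S F Fh \<longleftrightarrow>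
     curvature_line_net m \<Gamma> F \<and> curvature_line_net m \<Gamma> Fh \<and>
     (\<forall>t\<in>D. \<exists>Q. represents_sphere m (S t) Q \<and> cells_on F Fh (cell t {1..m}) Q)"

definition ribaucour_pair ::
  "nat \<Rightarrow> (nat \<Rightarrow> int) set \<Rightarrow>
   ((nat \<Rightarrow> int) \<Rightarrow> 'n::finite minkowski) \<Rightarrow> ((nat \<Rightarrow> int) \<Rightarrow> 'n minkowski) \<Rightarrow> bool" where
  "ribaucour_pair m \<Gamma> F Fh \<longleftrightarrow>
     (\<forall>k t I. 1 \<le> k \<and> k \<le> m \<and> elementary_cell m \<Gamma> k t I \<longrightarrow>
        (\<exists>Q. is_sphere k Q \<and> cells_on F Fh (cell t I) Q)) \<and>
     (\<forall>t j Q. elementary_cell m \<Gamma> 1 t {j} \<and> is_sphere 1 Q \<and> cells_on F Fh (cell t {j}) Q \<longrightarrow>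
        \<not> separate_on Q (point (F t)) (point (F (vertex t {j})))
                       (point (Fh t)) (point (Fh (vertex t {j}))))"

end

(* Write R_s for the reflection in the hyperplane orthogonal to a spacelike unit vector s; in the
   Clifford algebra it is v \<mapsto> s v s.  Conjugation by \<Phi>(t) is a linear isometry \<rho>_t, and \<rho> at
   t + t_j is \<rho>_t R_{s_j} R_{e_j}, where R_{e_j} fixes e_0 and e_\<infinity>.  Equating the two values of \<Phi> at
   the far vertex of a 2-cell gives \<sigma>_j s_i = - \<sigma>_i s_j with \<sigma>_j = R_{e_i} s_j(t + t_i + t_j / 2) and
   \<sigma>_i = R_{e_j} s_i(t + t_j + t_i / 2).  Commutators with suitable vectors then put \<sigma>_j into
   span {s_i, s_j}, so the space spanned by e_0, e_\<infinity> and the s_i decreases when one passes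
   from a cell to one of its faces; induction over the vertices puts the whole cell on the sphere.
   The same relation collapses both products in the cross ratio to multiples of v s_j and s_j v.
   Non-separation is a statement about the null vectors of a 3-space: stereographic projection from
   e_0 gives an explicit path from e_\<infinity> to its reflection that avoids the other two points, because
   the Gram determinant of e_0, e_\<infinity>, s is not positive. *)

theory Submission
  imports Defs
begin

section \<open>The Lorentz product and the Clifford algebra\<close>

lemma lorentz_commute: "lorentz v w = lorentz w v"
  by (simp add: lorentz_def mult_ac)

lemma lorentz_add_left [simp]: "lorentz (u + v) w = lorentz u w + lorentz v w"
  by (simp add: lorentz_def algebra_simps sum.distrib)

lemma lorentz_scaleR_left [simp]: "lorentz (r *\<^sub>R v) w = r * lorentz v w"
  by (simp add: lorentz_def sum_distrib_left mult_ac)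

lemma lorentz_add_right [simp]: "lorentz w (u + v) = lorentz w u + lorentz w v"
  by (simp add: lorentz_commute[of w])

lemma lorentz_scaleR_right [simp]: "lorentz w (r *\<^sub>R v) = r * lorentz w v"
  by (simp add: lorentz_commute[of w])

lemma lorentz_diff_left [simp]: "lorentz (u - v) w = lorentz u w - lorentz v w"
  using lorentz_add_left[of "u - v" v w] by simp

lemma lorentz_diff_right [simp]: "lorentz w (u - v) = lorentz w u - lorentz w v"
  by (simp add: lorentz_commute[of w])

lemma lorentz_zero [simp]: "lorentz 0 w = 0" "lorentz w 0 = 0"
  by (simp_all add: lorentz_def)

lemma lorentz_nondegenerate:
  assumes "v \<noteq> 0"
  shows "\<exists>y. lorentz v y \<noteq> 0"
proof -
  obtain i where i: "v $ i \<noteq> 0" using assms by (auto simp: vec_eq_iff)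
  have "lorentz v (axis i 1) = (\<Sum>j\<in>UNIV. if j = i then (if i = None then - 1 else 1) * v $ i else 0)"
    unfolding lorentz_def by (intro sum.cong) (auto simp: axis_def)
  then show ?thesis using i by (intro exI[of _ "axis i 1"]) simp
qed

lemma lorentz_time_space: "lorentz v w = (\<Sum>i\<in>UNIV. v $ Some i * w $ Some i) - v $ None * w $ None"
proof -
  have U: "(UNIV :: 'a option option set) = insert None (range Some)" by (rule UNIV_option_conv)
  show ?thesis
    unfolding lorentz_def U by (subst sum.insert) (auto simp: sum.reindex)
qed

text \<open>Cauchy-Schwarz for the spatial parts bounds the squared product of the time coordinates.
  As the spatial part of \<open>u\<close> is shorter than its time coordinate, that of
  \<open>v\<close> is longer.\<close>

lemma lorentz_orthogonal_timelike:
  assumes u: "lorentz u u < 0" and uv: "lorentz u v = 0" and v: "v \<noteq> 0"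
  shows "lorentz v v > 0"
proof -
  let ?S = "\<lambda>v w. \<Sum>i\<in>UNIV. v $ Some i * w $ Some i :: real"
  have cs: "(?S u v)\<^sup>2 \<le> ?S u u * ?S v v"
    using Cauchy_Schwarz_ineq_sum[of "\<lambda>i. u $ Some i" "\<lambda>i. v $ Some i" UNIV]
    by (simp add: power2_eq_square)
  have uu: "?S u u < (u $ None)\<^sup>2" using u by (simp add: lorentz_time_space power2_eq_square)
  have Suv: "?S u v = u $ None * v $ None" using uv by (simp add: lorentz_time_space)
  have uu0: "?S u u \<ge> 0" and vv0: "?S v v \<ge> 0" by (intro sum_nonneg; simp)+
  have *: "(u $ None)\<^sup>2 * (v $ None)\<^sup>2 \<le> ?S u u * ?S v v"
    using cs by (simp add: Suv power_mult_distrib)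
  \<comment> \<open>The strict estimate below multiplies by \<open>?S v v\<close>. If it vanished,
    the time coordinate of \<open>v\<close> would vanish too.\<close>
  have "?S v v \<noteq> 0"
  proof
    assume z: "?S v v = 0"
    then have "\<forall>i. v $ Some i = 0" by (simp add: sum_nonneg_eq_0_iff)
    moreover have "(u $ None)\<^sup>2 * (v $ None)\<^sup>2 \<le> 0" using * z by simp
    then have "v $ None = 0" using uu uu0 by (auto simp: mult_le_0_iff)
    ultimately show False using v by (auto simp: vec_eq_iff split_option_all)
  qed
  then have "?S u u * ?S v v < (u $ None)\<^sup>2 * ?S v v"
    using uu vv0 by (intro mult_strict_right_mono) auto
  then have "(v $ None)\<^sup>2 < ?S v v"
    using * uu uu0 by (smt (verit) mult_less_cancel_left_pos)
  then show ?thesis by (simp add: lorentz_time_space power2_eq_square)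
qed

section \<open>Vectors inside the Clifford algebra\<close>

lemma cl_add [simp]: "cl (v + w) = cl v + cl w"
  by (rule clifford_eqI) (auto simp: cl_def plus_clifford_def simp flip: sum.distrib intro!: sum.cong)

lemma cl_scaleR [simp]: "cl (r *\<^sub>R v) = r *\<^sub>R cl v"
  by (rule clifford_eqI) (simp add: cl_def scaleR_clifford_def sum_distrib_left if_distrib cong: sum.cong if_cong)

lemma linear_cl: "linear cl"
  by (simp add: linear_iff)

lemma cl_diff [simp]: "cl (v - w) = cl v - cl w"
  by (rule linear_diff[OF linear_cl])

lemma cl_uminus [simp]: "cl (- v) = - cl v"
  by (rule linear_neg[OF linear_cl])

lemma linear_grade_one: "linear grade_one"
  by (simp add: linear_iff grade_one_def vec_eq_iff blade_coeff_add blade_coeff_scaleR)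

lemma cl_eq_iff [simp]: "cl v = cl w \<longleftrightarrow> v = w"
  by (rule inj_eq[OF inj_cl])

lemma cl_anticommute: "cl v * cl w = - (cl w * cl v) - (2 * lorentz v w) *\<^sub>R 1"
  using clifford_relation[of v w] by (simp add: of_real_def eq_diff_eq eq_neg_iff_add_eq_0 mult.commute add_ac)

lemma cl_square: "cl v * cl v = - lorentz v v *\<^sub>R 1"
proof -
  have "2 *\<^sub>R (cl v * cl v) = 2 *\<^sub>R (- lorentz v v *\<^sub>R 1)"
    using clifford_relation[of v v] by (simp add: of_real_def scaleR_2 algebra_simps)
  then show ?thesis by (simp only: scaleR_cancel_left) simp
qed

lemma cl_mult_self_unit:
  assumes "lorentz s s = 1"
  shows "cl s * cl s = - 1" "cl s * (cl s * x) = - x"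
  using cl_square[of s] assms by (simp_all flip: mult.assoc)

section \<open>Reflections and conjugation by spin elements\<close>

definition lorentz_reflection :: "'n::finite minkowski \<Rightarrow> 'n minkowski \<Rightarrow> 'n minkowski" where
  "lorentz_reflection s v = v - (2 * lorentz s v) *\<^sub>R s"

lemma cl_sandwich:
  assumes "lorentz s s = 1"
  shows "cl s * cl v * cl s = cl (lorentz_reflection s v)"
  using cl_mult_self_unit[OF assms]
  by (simp add: lorentz_reflection_def cl_anticommute[of s v] algebra_simps)

text \<open>A null \<open>v\<close> has Clifford square 0, so moving \<open>cl v\<close> past
  \<open>cl s\<close> leaves only the scalar term. This is what collapses the products in the cross
  ratio.\<close>

lemma cl_sandwich_null:
  assumes "lorentz v v = 0"
  shows "cl v * cl s * cl v = - (2 * lorentz s v) *\<^sub>R cl v"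
  using cl_square[of v] assms
  by (simp add: cl_anticommute[of v s] algebra_simps lorentz_commute[of v s])

lemma lorentz_reflection_unit:
  "lorentz s s = 1 \<Longrightarrow> lorentz (lorentz_reflection s v) (lorentz_reflection s w) = lorentz v w"
  by (simp add: lorentz_reflection_def algebra_simps lorentz_commute[of v s])

lemma clifford_inv_eqI:
  assumes "x * y = 1" "y * x = 1"
  shows "clifford_inv x = y"
  unfolding clifford_inv_def
proof (rule the_equality)
  fix z assume "x * z = 1 \<and> z * x = 1"
  then have "z * (x * y) = z" "z * x * y = y" using assms by simp_all
  then show "z = y" by (simp add: mult.assoc)
qed (use assms in simp)

text \<open>For \<open>x\<close> in \<open>Spin\<close> the conjugate is again a vector
  (\<open>Spin_conj\<close>), so \<open>grade_one\<close> loses nothing.\<close>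

definition conj_by :: "'n::finite clifford \<Rightarrow> 'n minkowski \<Rightarrow> 'n minkowski" where
  "conj_by x v = grade_one (clifford_inv x * cl v * x)"

text \<open>Induction over the factors: \<open>cl s\<close> has inverse \<open>- cl s\<close>, and
  conjugation by it is minus the reflection in \<open>s\<close>.\<close>

lemma unit_product_conj:
  assumes "set \<sigma> \<subseteq> de_sitter"
  defines "x \<equiv> prod_list (map cl \<sigma>)"
  shows "\<exists>y. x * y = 1 \<and> y * x = 1 \<and> (\<forall>v. \<exists>w. y * cl v * x = cl w)"
  unfolding x_def using assms(1)
proof (induction \<sigma>)
  case (Cons s \<sigma>)
  let ?x = "prod_list (map cl \<sigma>)"
  have s: "lorentz s s = 1" using Cons.prems by (simp add: de_sitter_def)
  obtain y where xy: "?x * y = 1" and yx: "y * ?x = 1" and y: "\<And>v. \<exists>w. y * cl v * ?x = cl w"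
    using Cons by auto
  have 1: "(cl s * ?x) * (- (y * cl s)) = 1"
  proof -
    have "(cl s * ?x) * (- (y * cl s)) = - (cl s * (?x * y) * cl s)" by (simp add: mult.assoc)
    then show ?thesis by (simp add: xy cl_mult_self_unit[OF s])
  qed
  have 2: "(- (y * cl s)) * (cl s * ?x) = 1"
    by (simp add: yx mult.assoc cl_mult_self_unit[OF s])
  have 3: "\<exists>w. (- (y * cl s)) * cl v * (cl s * ?x) = cl w" for v
  proof -
    obtain w where w: "y * cl (lorentz_reflection s v) * ?x = cl w" using y by blast
    have "(- (y * cl s)) * cl v * (cl s * ?x) = - (y * (cl s * cl v * cl s) * ?x)"
      by (simp add: mult.assoc)
    also have "\<dots> = cl (- 1 *\<^sub>R w)"
      unfolding cl_sandwich[OF s] w cl_scaleR by simp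
    finally show ?thesis by blast
  qed
  show ?case using 1 2 3 by (intro exI[of _ "- (y * cl s)"]) simp
qed (auto intro!: exI[of _ 1])

context
  fixes x :: "'n::finite clifford"
  assumes x: "x \<in> Spin"
begin

lemma Spin_inverse: "x * clifford_inv x = 1" "clifford_inv x * x = 1"
  and Spin_conj: "clifford_inv x * cl v * x = cl (conj_by x v)"
proof -
  obtain \<sigma> where "x = prod_list (map cl \<sigma>)" "set \<sigma> \<subseteq> de_sitter"
    using x by (auto simp: Spin_def)
  then obtain y where y: "x * y = 1" "y * x = 1" "\<And>v. \<exists>w. y * cl v * x = cl w"
    using unit_product_conj by blast
  then have "clifford_inv x = y" by (intro clifford_inv_eqI)
  then show "x * clifford_inv x = 1" "clifford_inv x * x = 1"
      "clifford_inv x * cl v * x = cl (conj_by x v)"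
    using y(1,2) y(3)[of v] by (auto simp: conj_by_def)
qed

lemma Spin_inverse_assoc: "x * (clifford_inv x * y) = y" "clifford_inv x * (x * y) = y"
  by (simp_all add: Spin_inverse flip: mult.assoc)

lemma linear_conj_by: "linear (conj_by x)"
proof (rule linearI)
  show "conj_by x (v + w) = conj_by x v + conj_by x w" for v w
    by (simp add: conj_by_def algebra_simps linear_add[OF linear_grade_one])
  show "conj_by x (r *\<^sub>R v) = r *\<^sub>R conj_by x v" for r v
    by (simp add: conj_by_def linear_scale[OF linear_grade_one])
qed

text \<open>The symmetrized product of two vectors is a scalar, and conjugation fixes
  scalars.\<close>

lemma lorentz_conj_by [simp]: "lorentz (conj_by x v) (conj_by x w) = lorentz v w"
proof -
  have "cl (conj_by x v) * cl (conj_by x w) + cl (conj_by x w) * cl (conj_by x v)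
      = clifford_inv x * (cl v * cl w + cl w * cl v) * x"
    by (simp add: Spin_inverse_assoc algebra_simps flip: Spin_conj)
  also have "\<dots> = of_real (- 2 * lorentz v w)"
    unfolding clifford_relation by (simp add: of_real_def Spin_inverse)
  finally show ?thesis unfolding clifford_relation of_real_eq_iff by simp
qed

lemma conj_by_eq_0_iff [simp]: "conj_by x v = 0 \<longleftrightarrow> v = 0"
proof
  assume "conj_by x v = 0"
  then have "lorentz v w = 0" for w using lorentz_conj_by[of v w] by simp
  then show "v = 0" using lorentz_nondegenerate by blast
qed (simp add: linear_0[OF linear_conj_by])

lemma prod_list_conj_by:
  "prod_list (map (\<lambda>i. cl (conj_by x (f i))) is) = clifford_inv x * prod_list (map (\<lambda>i. cl (f i)) is) * x"
  by (induction "is") (simp_all add: Spin_inverse Spin_inverse_assoc mult.assoc flip: Spin_conj)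

text \<open>Conjugation is an algebra automorphism, hence acts on every summand factor by factor.
  This reads the formula for \<open>S\<close> as the wedge of transported vectors.\<close>

lemma wedge_conj_by: "wedge (map (conj_by x) vs) = clifford_inv x * wedge vs * x"
proof -
  let ?n = "length vs"
  have "prod_list (map (\<lambda>i. cl (map (conj_by x) vs ! p i)) [0..<?n])
      = clifford_inv x * prod_list (map (\<lambda>i. cl (vs ! p i)) [0..<?n]) * x"
    if "p permutes {..<?n}" for p
    unfolding prod_list_conj_by[symmetric]
    using permutes_in_image[OF that] by (intro arg_cong[of _ _ prod_list] map_cong) auto
  then have "(\<Sum>p | p permutes {..<?n}. of_int (sign p) * prod_list (map (\<lambda>i. cl (map (conj_by x) vs ! p i)) [0..<?n]))
      = (\<Sum>p | p permutes {..<?n}. clifford_inv x * (of_int (sign p) * prod_list (map (\<lambda>i. cl (vs ! p i)) [0..<?n])) * x)"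
    by (intro sum.cong) (auto simp: sign_def)
  then show ?thesis
    by (simp add: wedge_def sum_distrib_left sum_distrib_right)
qed

end

section \<open>Clifford consequences of the edge equation\<close>

lemma conj_by_step:
  assumes x: "x \<in> Spin" and x': "cl e * cl s * x \<in> Spin" and e: "lorentz e e = 1" and s: "lorentz s s = 1"
  shows "conj_by (cl e * cl s * x) v = conj_by x (lorentz_reflection s (lorentz_reflection e v))"
proof -
  note u = cl_mult_self_unit[OF e] cl_mult_self_unit[OF s] Spin_inverse[OF x] Spin_inverse_assoc[OF x]
  \<comment> \<open>The signs of the inverses \<open>- cl e\<close> and \<open>- cl s\<close>
    cancel.\<close>
  have "clifford_inv (cl e * cl s * x) = clifford_inv x * cl s * cl e"
    by (rule clifford_inv_eqI) (simp_all add: mult.assoc u)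
  then have "cl (conj_by (cl e * cl s * x) v) = clifford_inv x * (cl s * (cl e * cl v * cl e) * cl s) * x"
    unfolding Spin_conj[OF x', symmetric] by (simp only: mult.assoc)
  also have "\<dots> = cl (conj_by x (lorentz_reflection s (lorentz_reflection e v)))"
    by (simp add: cl_sandwich e s Spin_conj[OF x])
  finally show ?thesis by simp
qed

text \<open>Here \<open>s\<close> and \<open>r\<close> belong to the edges leaving the base vertex
  of a square, \<open>s'\<close> and \<open>r'\<close> to those entering the far vertex.
  Multiplication by \<open>cl e * cl e'\<close> from the left completes a sandwich on each
  side.\<close>

lemma commute_relation:
  assumes "cl e * cl e' = - (cl e' * cl e)" and e: "lorentz e e = 1" and e': "lorentz e' e' = 1"
    and eq: "cl e' * cl s' * cl e * cl s = cl e * cl r' * cl e' * cl r"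
  shows "cl (lorentz_reflection e s') * cl s = - (cl (lorentz_reflection e' r') * cl r)"
proof -
  note u = cl_mult_self_unit[OF e] cl_mult_self_unit[OF e']
  have "cl e * (cl e' * (cl e' * cl s' * cl e * cl s)) = (cl e * cl e') * (cl e * cl r' * cl e' * cl r)"
    unfolding eq by (simp add: mult.assoc)
  also have "\<dots> = cl e' * cl r' * cl e' * cl r"
    unfolding assms(1) by (simp add: mult.assoc u)
  finally have "- (cl e * cl s' * cl e * cl s) = cl e' * cl r' * cl e' * cl r"
    by (simp add: mult.assoc u)
  then show ?thesis
    unfolding cl_sandwich[OF e] cl_sandwich[OF e'] by (metis minus_minus)
qed

text \<open>Moving \<open>cl x\<close> through leaves one scalar term per factor. Thus an equation
  between products of two vectors yields equations between vectors.\<close>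

lemma cl_mult_commutator:
  "cl a * cl b * cl x - cl x * (cl a * cl b) = cl ((2 * lorentz a x) *\<^sub>R b - (2 * lorentz b x) *\<^sub>R a)"
proof -
  have "cl a * cl b * cl x = cl a * (- (cl x * cl b) - (2 * lorentz b x) *\<^sub>R 1)"
    by (simp add: cl_anticommute[of b x] mult.assoc)
  also have "\<dots> = - (cl a * cl x * cl b) - (2 * lorentz b x) *\<^sub>R cl a"
    by (simp add: algebra_simps)
  also have "\<dots> = cl x * (cl a * cl b) + (2 * lorentz a x) *\<^sub>R cl b - (2 * lorentz b x) *\<^sub>R cl a"
    by (simp add: cl_anticommute[of a x] algebra_simps)
  finally show ?thesis by (simp add: algebra_simps)
qed

text \<open>The commutator of both sides with an \<open>x\<close> orthogonal to \<open>d\<close> but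
  not to \<open>b\<close> leaves only \<open>d\<close> on the right and a nonzero multiple of
  \<open>a\<close> on the left.\<close>

lemma mem_span_if_products_opposite:
  assumes eq: "cl a * cl b = - (cl c * cl d)"
    and b: "lorentz b b = 1" and d: "lorentz d d = 1" and ne: "b \<noteq> d" "b \<noteq> - d"
  shows "a \<in> span {b, d}"
proof -
  define w where "w = b - lorentz b d *\<^sub>R d"
  have "w \<noteq> 0"
  proof
    assume "w = 0"
    then have b': "b = lorentz b d *\<^sub>R d" by (simp add: w_def)
    then have "lorentz b b = lorentz (lorentz b d *\<^sub>R d) b" by (rule arg_cong)
    then have "(lorentz b d)\<^sup>2 = 1" using b by (simp add: lorentz_commute[of d] power2_eq_square)
    then have "lorentz b d = 1 \<or> lorentz b d = - 1" by (simp add: power2_eq_1_iff)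
    then show False using b' ne by auto
  qed
  then obtain y where y: "lorentz w y \<noteq> 0" using lorentz_nondegenerate by blast
  \<comment> \<open>As \<open>w\<close> is the part of \<open>b\<close> orthogonal to
    \<open>d\<close>, the products of \<open>b\<close> with \<open>x\<close> and of \<open>w\<close>
    with \<open>y\<close> agree.\<close>
  define x where "x = y - lorentz d y *\<^sub>R d"
  have dx: "lorentz d x = 0" using d by (simp add: x_def)
  have bx: "lorentz b x \<noteq> 0" using y by (simp add: x_def w_def mult.commute)
  have "cl ((2 * lorentz a x) *\<^sub>R b - (2 * lorentz b x) *\<^sub>R a)
      = cl (- ((2 * lorentz c x) *\<^sub>R d))"
  proof -
    have "cl (- ((2 * lorentz c x) *\<^sub>R d)) = - (cl c * cl d * cl x - cl x * (cl c * cl d))"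
      unfolding cl_mult_commutator dx by simp
    also have "\<dots> = (cl a * cl b) * cl x - cl x * (cl a * cl b)"
      unfolding eq by simp
    finally show ?thesis unfolding cl_mult_commutator by simp
  qed
  then have "(2 * lorentz b x) *\<^sub>R a = (2 * lorentz a x) *\<^sub>R b + (2 * lorentz c x) *\<^sub>R d"
    by (simp only: cl_eq_iff) (simp add: algebra_simps)
  moreover have "\<dots> \<in> span {b, d}"
    by (intro span_add span_scale span_base) auto
  ultimately have "(2 * lorentz b x) *\<^sub>R a \<in> span {b, d}" by simp
  then have "inverse (2 * lorentz b x) *\<^sub>R ((2 * lorentz b x) *\<^sub>R a) \<in> span {b, d}"
    by (rule span_scale)
  then show ?thesis using bx by simp
qed

section \<open>Alternation of the wedge product\<close>

text \<open>Composing each permutation with the transposition of \<open>i\<close> and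
  \<open>j\<close> keeps the product and flips the sign, so the sum equals its own negative.\<close>

lemma wedge_repeated:
  assumes ij: "i < length vs" "j < length vs" "i \<noteq> j" and eq: "vs ! i = vs ! j"
  shows "wedge vs = 0"
proof -
  let ?n = "length vs"
  let ?T = "\<lambda>p. of_int (sign p) * prod_list (map (\<lambda>k. cl (vs ! p k)) [0..<?n])"
  let ?P = "{p. p permutes {..<?n}}"
  let ?\<tau> = "Transposition.transpose i j"
  have \<tau>: "?\<tau> permutes {..<?n}" using ij by (intro permutes_swap_id) auto
  have e: "vs ! ?\<tau> k = vs ! k" for k using eq by (simp add: Transposition.transpose_def)
  have "sum ?T ?P = (\<Sum>p\<in>?P. ?T (?\<tau> \<circ> p))"
  proof (rule sum.reindex_bij_betw[symmetric])
    show "bij_betw ((\<circ>) ?\<tau>) ?P ?P"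
      using permutes_compose[OF _ \<tau>]
      by (intro bij_betw_byWitness[of _ "(\<circ>) ?\<tau>"]) (auto simp flip: comp_assoc)
  qed
  also have "\<dots> = (\<Sum>p\<in>?P. - ?T p)"
  proof (rule sum.cong[OF refl])
    fix p assume "p \<in> ?P"
    then have "permutation p" by (auto simp: permutation_permutes)
    then have "sign (?\<tau> \<circ> p) = - sign p"
      using ij(3) by (simp add: sign_compose permutation_swap_id sign_swap_id)
    then show "?T (?\<tau> \<circ> p) = - ?T p" by (simp add: e)
  qed
  finally have "sum ?T ?P + sum ?T ?P = 0" by (simp only: sum_negf eq_neg_iff_add_eq_0)
  then have "2 *\<^sub>R sum ?T ?P = 0" by (simp only: scaleR_2)
  then show ?thesis by (simp add: wedge_def)
qed

lemma linear_wedge_entry: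
  assumes i: "i < length vs"
  shows "linear (\<lambda>x. wedge (vs[i := x]))"
proof -
  let ?n = "length vs"
  have lin: "linear (\<lambda>x. prod_list (map (\<lambda>k. cl (vs[i := x] ! p k)) [0..<?n]))"
    if p: "p permutes {..<?n}" for p
  proof -
    \<comment> \<open>The entry \<open>x\<close> occurs in each summand exactly once, at position
      \<open>k\<close>.\<close>
    obtain k where k: "p k = i" "k < ?n"
      using permutes_image[OF p] i by (metis imageE lessThan_iff)
    have ne: "p l \<noteq> i" if "l \<noteq> k" for l using permutes_inj[OF p] k(1) that by (auto dest: injD)
    have split: "[0..<?n] = [0..<k] @ k # [Suc k..<?n]"
      using k(2) by (metis upt_add_eq_append upt_conv_Cons le_add1 less_imp_add_positive less_or_eq_imp_le plus_nat.add_0 zero_le)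
    have "prod_list (map (\<lambda>k. cl (vs[i := x] ! p k)) [0..<?n])
        = prod_list (map (\<lambda>k. cl (vs ! p k)) [0..<k]) * cl x
          * prod_list (map (\<lambda>k. cl (vs ! p k)) [Suc k..<?n])" for x
    proof -
      have e: "map (\<lambda>l. cl (vs[i := x] ! p l)) ls = map (\<lambda>l. cl (vs ! p l)) ls" if "k \<notin> set ls" for ls
        using that ne by (intro map_cong refl arg_cong[of _ _ cl]) (metis nth_list_update_neq)
      show ?thesis
        unfolding split map_append list.map(2) prod_list.append prod_list.Cons using k i
        by (subst (1 2) e) (simp_all add: mult.assoc)
    qed
    then show ?thesis by (simp add: linear_iff algebra_simps)
  qed
  show ?thesis
    unfolding wedge_def length_list_update linear_iff
    using lin by (auto simp: linear_iff algebra_simps sum.distrib scaleR_sum_right)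
qed

text \<open>By multilinearity and alternation, the wedge vanishes as soon as one entry lies in the
  span of the others.\<close>

lemma wedge_nonzero_independent:
  assumes "wedge vs \<noteq> 0"
  shows "distinct vs \<and> independent (set vs)"
proof (rule ccontr)
  let ?n = "length vs"
  assume dep: "\<not> (distinct vs \<and> independent (set vs))"
  \<comment> \<open>Removing a position instead of a value lets a repeated entry count as a
    dependence.\<close>
  have "\<exists>i<?n. vs ! i \<in> span ((!) vs ` ({..<?n} - {i}))"
  proof (cases "distinct vs")
    case False
    then obtain i j where "i < ?n" "j < ?n" "i \<noteq> j" "vs ! i = vs ! j"
      by (auto simp: distinct_conv_nth)
    then show ?thesis by (intro exI[of _ i]) (auto intro!: span_base)
  next
    case True
    then have "dependent (set vs)" using dep by simp
    then obtain a where a: "a \<in> set vs" "a \<in> span (set vs - {a})" by (auto simp: dependent_def)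
    then obtain i where i: "i < ?n" "a = vs ! i" by (auto simp: in_set_conv_nth)
    have "set vs - {a} \<subseteq> (!) vs ` ({..<?n} - {i})" using i by (auto simp: in_set_conv_nth)
    then show ?thesis using a i span_mono by blast
  qed
  then obtain i where i: "i < ?n" "vs ! i \<in> span ((!) vs ` ({..<?n} - {i}))" by blast
  have "wedge (vs[i := vs ! i]) = 0"
  proof (rule linear_eq_0_on_span[OF linear_wedge_entry[OF i(1)] _ i(2)])
    fix x assume "x \<in> (!) vs ` ({..<?n} - {i})"
    then obtain j where "j < ?n" "j \<noteq> i" "x = vs ! j" by auto
    then show "wedge (vs[i := x]) = 0"
      using i(1) by (intro wedge_repeated[of i _ j]) auto
  qed
  then show False using assms by simp
qed

section \<open>Spheres and separation\<close>

lemma point_eq_span_mem: "point v = point w \<Longrightarrow> v \<in> span {w}"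
  unfolding point_def using span_base[of v "{v}"] by simp

lemma points_in_iff:
  assumes "subspace U" "v \<in> light_cone" "v \<noteq> 0"
  shows "point v \<in> points_in U \<longleftrightarrow> v \<in> U"
proof
  assume "point v \<in> points_in U"
  then obtain w where "point v = point w" "w \<in> U" by (auto simp: points_in_def)
  then have "v \<in> span {w}" "span {w} \<subseteq> U"
    using point_eq_span_mem assms(1) by (auto simp: span_minimal)
  then show "v \<in> U" by blast
qed (use assms in \<open>auto simp: points_in_def\<close>)

text \<open>Degenerate frames need this: a basis of \<open>span A\<close> is extended to one of the
  whole space and then cut down to \<open>d\<close> vectors.\<close>

lemma exists_independent_list:
  fixes A :: "'a::euclidean_space set"
  assumes "finite A" "card A \<le> d" "d \<le> DIM('a)"
  shows "\<exists>vs. length vs = d \<and> distinct vs \<and> independent (set vs) \<and> span A \<subseteq> span (set vs)"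
proof -
  obtain B where B: "B \<subseteq> A" "independent B" "A \<subseteq> span B"
    using maximal_independent_subset by blast
  obtain C where C: "B \<subseteq> C" "independent C" "UNIV \<subseteq> span C"
    using maximal_independent_subset_extend[OF _ B(2), of UNIV] by auto
  have "finite C" using C(2) by (rule finiteI_independent)
  have "card C = DIM('a)"
    using basis_card_eq_dim[of C UNIV] C by auto
  moreover have "card B \<le> d" using card_mono[OF assms(1) B(1)] assms(2) by simp
  ultimately obtain D where D: "B \<subseteq> D" "D \<subseteq> C" "card D = d"
    using exists_subset_between[of B d C] C(1) \<open>finite C\<close> assms(3) by auto
  obtain vs where vs: "set vs = D" "distinct vs"
    using finite_distinct_list finite_subset[OF D(2) \<open>finite C\<close>] by blast
  have "span A \<subseteq> span D"
    using B(3) span_mono[OF D(1)] by (intro span_minimal) auto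
  then show ?thesis
    using vs D distinct_card[OF vs(2)] independent_mono[OF C(2) D(2)] by (intro exI[of _ vs]) auto
qed

lemma exists_sphere_containing:
  fixes A :: "'n::finite minkowski set"
  assumes "finite A" "card A \<le> k + 2" "k \<le> CARD('n)"
    and "v \<in> span A" "lorentz v v < 0"
  shows "\<exists>U. subspace U \<and> span A \<subseteq> U \<and> is_sphere k (points_in U)"
proof -
  obtain vs :: "'n minkowski list" where vs: "length vs = k + 2" "distinct vs" "independent (set vs)"
      "span A \<subseteq> span (set vs)"
    using exists_independent_list[of A "k + 2"] assms by (auto simp: card_UNIV_option)
  then have "is_sphere k (points_in (span (set vs)))"
    unfolding is_sphere_def represents_sphere_def using assms(4,5) by blast
  then show ?thesis using vs(4) by blast
qed

lemma represents_sphere_wedge: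
  assumes "wedge vs \<noteq> 0" "length vs = k + 2" "v \<in> span (set vs)" "lorentz v v < 0"
  shows "represents_sphere k (wedge vs) (points_in (span (set vs)))"
  unfolding represents_sphere_def using assms wedge_nonzero_independent[OF assms(1)] by blast

text \<open>The left side is -4 times the Gram determinant of \<open>a\<close>, \<open>c\<close>,
  \<open>s\<close>. The part \<open>u\<close> of \<open>a\<close> orthogonal to \<open>s\<close> is
  timelike, so \<open>w\<close>, orthogonal to \<open>u\<close>, is spacelike or 0; in the latter
  case \<open>a\<close> is the multiple excluded by \<open>ne\<close>.\<close>

lemma lorentz_gram_null_null_unit:
  assumes a: "lorentz a a = 0" and c: "lorentz c c = 0" and ac: "lorentz a c = - 1 / 2"
    and s: "lorentz s s = 1" and as: "lorentz s a \<noteq> 0"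
    and ne: "a \<noteq> (4 * (lorentz s a)\<^sup>2) *\<^sub>R lorentz_reflection s c"
  shows "1 + 4 * lorentz s a * lorentz s c > 0"
proof -
  let ?\<alpha> = "lorentz s a" and ?\<beta> = "lorentz s c"
  define u where "u = a - ?\<alpha> *\<^sub>R s"
  \<comment> \<open>A multiple of the component of \<open>c\<close> orthogonal to \<open>s\<close> and the timelike vector \<open>u\<close>.\<close>
  define w where "w = ?\<alpha>\<^sup>2 *\<^sub>R (c - ?\<beta> *\<^sub>R s) - (1 / 2 + ?\<alpha> * ?\<beta>) *\<^sub>R u"
  note com = lorentz_commute[of a s] lorentz_commute[of c s] lorentz_commute[of c a]
  have uu: "lorentz u u = - ?\<alpha>\<^sup>2"
    by (simp add: u_def com a s power2_eq_square)
  have uw: "lorentz u w = 0"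
    by (simp add: u_def w_def com a c s ac power2_eq_square algebra_simps)
  have ww: "lorentz w w = ?\<alpha>\<^sup>2 * (1 / 4 + ?\<alpha> * ?\<beta>)"
    by (simp add: u_def w_def com a c s ac power2_eq_square field_simps)
  have "w \<noteq> 0"
  proof
    assume w: "w = 0"
    then have z: "?\<alpha> * ?\<beta> = - 1 / 4" using ww as by simp
    then have "?\<alpha>\<^sup>2 * ?\<beta> = - ?\<alpha> / 4" by (simp add: power2_eq_square mult.assoc)
    then have "4 *\<^sub>R w = (4 * ?\<alpha>\<^sup>2) *\<^sub>R lorentz_reflection s c - a"
      unfolding w_def u_def lorentz_reflection_def z
      by (simp add: algebra_simps flip: scaleR_add_left)
    then show False using ne w by simp
  qed
  then have "lorentz w w > 0"
    using as uu uw by (intro lorentz_orthogonal_timelike[of u]) auto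
  then show ?thesis
    using as ww by (simp add: zero_less_mult_iff)
qed

lemma point_scaleR:
  assumes "r \<noteq> 0"
  shows "point (r *\<^sub>R v) = point v"
proof -
  have "r *\<^sub>R v \<in> span {v}" by (simp add: span_base span_scale)
  moreover have "(1 / r) *\<^sub>R (r *\<^sub>R v) \<in> span {r *\<^sub>R v}" by (intro span_scale span_base) simp
  then have "v \<in> span {r *\<^sub>R v}" using assms by simp
  ultimately show ?thesis
    unfolding point_def by (intro equalityI span_minimal subspace_span) simp_all
qed

text \<open>In the application \<open>a\<close> and \<open>c\<close> are the values of the two nets
  at a vertex, and their reflections are proportional to or equal to those at the other end of an
  edge.\<close>

lemma not_separate_reflected:
  fixes a c s :: "'n::finite minkowski"
  assumes a: "lorentz a a = 0" and c: "lorentz c c = 0" and ac: "lorentz a c = - 1 / 2"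
    and s: "lorentz s s = 1" and U: "subspace U"
  shows "\<not> separate_on (points_in U) (point a) (point (lorentz_reflection s a))
           (point c) (point (lorentz_reflection s c))"
proof
  let ?b = "lorentz_reflection s a" and ?d = "lorentz_reflection s c" and ?Q = "points_in U"
  let ?\<alpha> = "lorentz s a" and ?\<beta> = "lorentz s c"
  note com = lorentz_commute[of a s] lorentz_commute[of c s] lorentz_commute[of c a]
  assume sep: "separate_on ?Q (point a) (point ?b) (point c) (point ?d)"
  then have pts: "point a \<in> ?Q" "point ?b \<in> ?Q" "point c \<in> ?Q" "point a \<noteq> point ?b"
      "point ?d \<noteq> point a" by (auto simp: separate_on_def)
  have nz: "a \<noteq> 0" "c \<noteq> 0" using ac by auto
  have bb: "lorentz ?b ?b = 0" and dd: "lorentz ?d ?d = 0"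
    using a c s by (simp_all add: lorentz_reflection_unit)
  have "lorentz ?b ?d = - 1 / 2" using ac s by (simp add: lorentz_reflection_unit)
  then have nz': "?b \<noteq> 0" "?d \<noteq> 0" by auto
  have \<alpha>: "?\<alpha> \<noteq> 0" using pts(4) by (auto simp: lorentz_reflection_def)
  have memU: "a \<in> U" "?b \<in> U" "c \<in> U"
    using pts a c bb nz nz' U by (simp_all add: points_in_iff light_cone_def)
  \<comment> \<open>This vector is \<open>s\<close>: a reflection moves \<open>a\<close> along
    \<open>s\<close>.\<close>
  have "(1 / (2 * ?\<alpha>)) *\<^sub>R (a - ?b) \<in> U"
    using memU U by (intro subspace_scale subspace_diff)
  then have sU: "s \<in> U" using \<alpha> by (simp add: lorentz_reflection_def)
  \<comment> \<open>Up to scaling, the null vector other than \<open>a\<close> in the span of \<open>a\<close> and \<open>c + \<tau> s\<close>.\<close>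
  define f where "f \<tau> = (1 - 2 * \<tau> * ?\<alpha>) *\<^sub>R (c + \<tau> *\<^sub>R s) + (\<tau>\<^sup>2 + 2 * \<tau> * ?\<beta>) *\<^sub>R a" for \<tau>
  have f_null: "lorentz (f \<tau>) (f \<tau>) = 0" for \<tau>
    by (simp add: f_def com a c s ac power2_eq_square field_simps)
  have fa: "lorentz (f \<tau>) a = - (1 - 2 * \<tau> * ?\<alpha>)\<^sup>2 / 2" for \<tau>
    by (simp add: f_def com a c s ac power2_eq_square field_simps)
  have fb: "lorentz (f \<tau>) ?b = - (1 + 4 * ?\<alpha> * ?\<beta>) / 2" for \<tau>
    by (simp add: f_def lorentz_reflection_def com a c s ac power2_eq_square field_simps)
  \<comment> \<open>At \<open>- 2 * ?\<beta>\<close> the coefficient of \<open>a\<close> vanishes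
    and \<open>c + \<tau> *\<^sub>R s\<close> is the reflection of \<open>c\<close>.\<close>
  have f_ends: "f 0 = c" "f (- 2 * ?\<beta>) = (1 + 4 * ?\<alpha> * ?\<beta>) *\<^sub>R ?d"
    by (simp_all add: f_def lorentz_reflection_def algebra_simps power2_eq_square)
  have pos: "1 + 4 * ?\<alpha> * ?\<beta> > 0"
  proof (rule lorentz_gram_null_null_unit[OF a c ac s \<alpha>])
    have "point ((4 * ?\<alpha>\<^sup>2) *\<^sub>R ?d) = point ?d" using \<alpha> by (intro point_scaleR) simp
    then show "a \<noteq> (4 * ?\<alpha>\<^sup>2) *\<^sub>R ?d" using pts(5) by metis
  qed
  \<comment> \<open>By \<open>fa\<close> the path meets the line of \<open>a\<close> only where this
    affine expression vanishes. It is 1 at one end of the segment and positive at the other by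
    \<open>pos\<close>.\<close>
  have pos_\<tau>: "1 - 2 * \<tau> * ?\<alpha> > 0" if \<tau>: "\<tau> \<in> closed_segment 0 (- 2 * ?\<beta>)" for \<tau>
  proof -
    obtain \<theta> where \<theta>: "0 \<le> \<theta>" "\<theta> \<le> 1" "\<tau> = (1 - \<theta>) *\<^sub>R 0 + \<theta> *\<^sub>R (- 2 * ?\<beta>)"
      using \<tau> unfolding in_segment by blast
    have "2 * \<tau> * ?\<alpha> = \<theta> * (- 4 * (?\<alpha> * ?\<beta>))"
      unfolding \<theta>(3) by simp
    also have "\<dots> < 1"
    proof (cases "?\<alpha> * ?\<beta> < 0")
      case True
      then have "\<theta> * (- 4 * (?\<alpha> * ?\<beta>)) \<le> 1 * (- 4 * (?\<alpha> * ?\<beta>))"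
        using \<theta>(2) by (intro mult_right_mono) linarith+
      then show ?thesis using pos by (simp add: mult.assoc)
    next
      case False
      then have "\<theta> * (- 4 * (?\<alpha> * ?\<beta>)) \<le> 0"
        using \<theta>(1) by (simp add: mult_nonneg_nonneg)
      then show ?thesis by simp
    qed
    finally show ?thesis by linarith
  qed
  let ?I = "f ` closed_segment 0 (- 2 * ?\<beta>)"
  \<comment> \<open>A multiple of a null vector is orthogonal to it.\<close>
  have ne: "point v \<noteq> point w" if "lorentz v w \<noteq> 0" "lorentz w w = 0" for v w :: "'n minkowski"
    using that point_eq_span_mem[of v w] by (auto simp: span_singleton)
  have "?I \<subseteq> \<Union>(?Q - {point a, point ?b}) - {0}"
  proof
    fix v assume "v \<in> ?I"
    then obtain \<tau> where v: "v = f \<tau>" "\<tau> \<in> closed_segment 0 (- 2 * ?\<beta>)" by blast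
    have "lorentz v a \<noteq> 0" "lorentz v ?b \<noteq> 0"
      using pos_\<tau>[OF v(2)] pos unfolding v(1) fa fb by auto
    then have "point v \<noteq> point a" "point v \<noteq> point ?b" "v \<noteq> 0"
      using ne a bb by auto
    moreover have "v \<in> U"
      unfolding v(1) f_def using memU sU U by (intro subspace_add subspace_scale)
    then have "point v \<in> ?Q"
      using U f_null \<open>v \<noteq> 0\<close> by (subst points_in_iff) (auto simp: light_cone_def v(1))
    moreover have "v \<in> point v" by (simp add: point_def span_base)
    ultimately show "v \<in> \<Union>(?Q - {point a, point ?b}) - {0}" by blast
  qed
  moreover have "connected ?I"
    unfolding f_def by (intro connected_continuous_image continuous_intros) auto
  moreover have "f 0 \<in> ?I" "f (- 2 * ?\<beta>) \<in> ?I" by auto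
  ultimately have "connected_component (\<Union>(?Q - {point a, point ?b}) - {0}) (f 0) (f (- 2 * ?\<beta>))"
    unfolding connected_component_def by blast
  moreover have "f 0 \<in> point c" "f (- 2 * ?\<beta>) \<in> point ?d"
    unfolding f_ends point_def by (auto intro!: span_base span_scale)
  ultimately have "\<exists>v\<in>point c. \<exists>w\<in>point ?d. connected_component (\<Union>(?Q - {point a, point ?b}) - {0}) v w"
    by (intro bexI[of _ "f 0"] bexI[of _ "f (- 2 * ?\<beta>)"])
  then show False using sep unfolding separate_on_def by (elim conjE) (rule notE)
qed

section \<open>Cells of the lattice\<close>

lemma vertex_empty [simp]: "vertex t {} = t"
  by (simp add: vertex_def)

lemma vertex_vertex: "j \<notin> K \<Longrightarrow> vertex (vertex t {j}) K = vertex t (insert j K)"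
  by (auto simp: vertex_def)

lemma cell_vertex_subset:
  assumes "j \<in> I"
  shows "cell (vertex t {j}) (I - {j}) \<subseteq> cell t I"
proof
  fix u assume "u \<in> cell (vertex t {j}) (I - {j})"
  then obtain K where "K \<subseteq> I - {j}" "u = vertex (vertex t {j}) K" by (auto simp: cell_def)
  then show "u \<in> cell t I"
    using assms by (subst (asm) vertex_vertex) (auto simp: cell_def)
qed

lemma cell_mono: "I \<subseteq> J \<Longrightarrow> cell t I \<subseteq> cell t J"
  by (auto simp: cell_def)

section \<open>Composed reflections and the cross ratio\<close>

lemma linear_lorentz_reflection: "linear (lorentz_reflection s)"
  by (rule linearI) (simp_all add: lorentz_reflection_def algebra_simps)

text \<open>An isometry g carries the reflection in \<open>s\<close> to the reflection in
  g(\<open>s\<close>); here g is the reflection in \<open>e\<close>.\<close>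

lemma lorentz_reflection_conj:
  assumes "lorentz e e = 1"
  shows "lorentz_reflection e (lorentz_reflection s v)
    = lorentz_reflection (lorentz_reflection e s) (lorentz_reflection e v)"
proof -
  have "lorentz_reflection e (lorentz_reflection s v)
      = lorentz_reflection e v - (2 * lorentz s v) *\<^sub>R lorentz_reflection e s"
    by (subst (2) lorentz_reflection_def)
      (simp add: linear_diff[OF linear_lorentz_reflection] linear_scale[OF linear_lorentz_reflection])
  then show ?thesis
    using lorentz_reflection_unit[OF assms] by (simp add: lorentz_reflection_def[of "lorentz_reflection e s"])
qed

lemma conj_by_reflection:
  assumes "x \<in> Spin"
  shows "conj_by x (lorentz_reflection s v) = lorentz_reflection (conj_by x s) (conj_by x v)"
  by (simp add: lorentz_reflection_def assms linear_diff[OF linear_conj_by] linear_scale[OF linear_conj_by])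

lemma lorentz_reflection_in_span:
  assumes "s \<in> span A" "v \<in> span A"
  shows "lorentz_reflection s v \<in> span A"
  unfolding lorentz_reflection_def using assms by (intro span_diff span_scale)

text \<open>For unit vectors, reversing a product of two gives its inverse, so this is the equation
  between the inverses.\<close>

lemma products_opposite_reverse:
  assumes eq: "cl p * cl a = - (cl q * cl b)"
    and "lorentz a a = 1" "lorentz b b = 1" "lorentz p p = 1" "lorentz q q = 1"
  shows "cl a * cl p = - (cl b * cl q)"
proof -
  note u = cl_mult_self_unit[OF assms(2)] cl_mult_self_unit[OF assms(3)]
    cl_mult_self_unit[OF assms(4)] cl_mult_self_unit[OF assms(5)]
  have "cl a * cl p = cl a * cl p * (cl q * cl b) * (cl b * cl q)"
    by (simp add: mult.assoc u)
  also have "cl q * cl b = - (cl p * cl a)" using eq by simp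
  also have "cl a * cl p * (- (cl p * cl a)) * (cl b * cl q) = - (cl b * cl q)"
    by (simp add: mult.assoc u)
  finally show ?thesis .
qed

text \<open>Here \<open>a\<close>, \<open>b\<close> stand for s_i, s_j and \<open>p\<close>,
  \<open>q\<close> for \<sigma>_j, \<sigma>_i. The two products become the same multiple of
  \<open>cl v * cl b\<close> and of \<open>cl b * cl v\<close>, whose sum is a scalar.\<close>

lemma cross_ratio_closed_quad:
  assumes eq: "cl p * cl a = - (cl q * cl b)"
    and a: "lorentz a a = 1" and b: "lorentz b b = 1" and p: "lorentz p p = 1" and q: "lorentz q q = 1"
    and v: "lorentz v v = 0" and x: "x \<in> Spin"
  shows "cross_ratio (conj_by x v) (conj_by x (lorentz_reflection a v))
    (conj_by x (lorentz_reflection a (lorentz_reflection p v))) (conj_by x (lorentz_reflection b v)) \<in> \<real>"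
proof -
  let ?V = "cl v" and ?w2 = "lorentz_reflection a v" and ?w3 = "lorentz_reflection a (lorentz_reflection p v)"
    and ?w4 = "lorentz_reflection b v"
  define k where "k = 8 * lorentz a v * lorentz p v * lorentz q v"
  note u = cl_mult_self_unit[OF a] cl_mult_self_unit[OF b] cl_mult_self_unit[OF p] cl_mult_self_unit[OF q]
  have w: "cl ?w2 = cl a * ?V * cl a" "cl ?w3 = cl a * (cl p * ?V * cl p) * cl a" "cl ?w4 = cl b * ?V * cl b"
    by (simp_all add: cl_sandwich a b p)
  \<comment> \<open>Every vector between two factors \<open>?V\<close> collapses to a scalar.
    Trading \<open>cl p * cl a\<close> for \<open>- (cl q * cl b)\<close> lets \<open>cl b\<close>
    cancel and opens the last such sandwich, around \<open>cl q\<close>.\<close>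
  have "?V * cl ?w2 * cl ?w3 * cl ?w4 = - ((?V * cl a * ?V) * cl p * ?V * (cl p * cl a) * cl b * ?V * cl b)"
    by (simp add: w mult.assoc u)
  also have "\<dots> = (- 2 * lorentz a v) *\<^sub>R ((?V * cl p * ?V) * cl q * cl b * cl b * ?V * cl b)"
    unfolding cl_sandwich_null[OF v, of a] eq by (simp add: mult.assoc)
  also have "\<dots> = (- 4 * lorentz a v * lorentz p v) *\<^sub>R ((?V * cl q * ?V) * cl b)"
    unfolding cl_sandwich_null[OF v, of p] by (simp add: mult.assoc u)
  also have "\<dots> = k *\<^sub>R (?V * cl b)"
    unfolding cl_sandwich_null[OF v] by (simp add: k_def)
  finally have 1: "?V * cl ?w2 * cl ?w3 * cl ?w4 = k *\<^sub>R (?V * cl b)" .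
  note eq' = products_opposite_reverse[OF eq a b p q]
  have "cl ?w4 * cl ?w3 * cl ?w2 * ?V = - (cl b * ?V * cl b * (cl a * cl p) * ?V * cl p * (?V * cl a * ?V))"
    by (simp add: w mult.assoc u)
  also have "\<dots> = (- 2 * lorentz a v) *\<^sub>R (cl b * ?V * cl b * cl b * cl q * (?V * cl p * ?V))"
    unfolding cl_sandwich_null[OF v, of a] eq' by (simp add: mult.assoc)
  also have "\<dots> = (- 4 * lorentz a v * lorentz p v) *\<^sub>R (cl b * (?V * cl q * ?V))"
    unfolding cl_sandwich_null[OF v, of p] by (simp add: mult.assoc u)
  also have "\<dots> = k *\<^sub>R (cl b * ?V)"
    unfolding cl_sandwich_null[OF v] by (simp add: k_def)
  finally have 2: "cl ?w4 * cl ?w3 * cl ?w2 * ?V = k *\<^sub>R (cl b * ?V)" .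
  let ?c = "\<lambda>v. cl (conj_by x v)"
  have prod4: "?c v1 * ?c v2 * ?c v3 * ?c v4 = clifford_inv x * (cl v1 * cl v2 * cl v3 * cl v4) * x" for v1 v2 v3 v4
    by (simp add: mult.assoc Spin_inverse_assoc[OF x] flip: Spin_conj[OF x])
  have "?c v * ?c ?w2 * ?c ?w3 * ?c ?w4 + ?c ?w4 * ?c ?w3 * ?c ?w2 * ?c v
      = clifford_inv x * (k *\<^sub>R (?V * cl b + cl b * ?V)) * x"
    unfolding prod4 1 2 by (simp add: algebra_simps)
  also have "\<dots> = of_real (k * (- 2 * lorentz v b))"
    unfolding clifford_relation by (simp add: of_real_def Spin_inverse[OF x])
  finally show ?thesis unfolding cross_ratio_def by (simp add: scaleR_conv_of_real)
qed

lemma clifford_relation_eq_iff: "cl v * cl w + cl w * cl v = of_real r \<longleftrightarrow> lorentz v w = - r / 2"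
  unfolding clifford_relation of_real_eq_iff by auto

lemma pseudo_orthonormal_lorentz:
  assumes "pseudo_orthonormal e0 e einf"
  shows "lorentz e0 e0 = 0" "lorentz einf einf = 0" "lorentz e0 einf = - 1 / 2"
    and "i \<in> {1..CARD('n)} \<Longrightarrow> lorentz (e i) (e i) = 1"
    and "i \<in> {1..CARD('n)} \<Longrightarrow> lorentz (e i) e0 = 0"
    and "i \<in> {1..CARD('n)} \<Longrightarrow> lorentz (e i) (einf :: 'n::finite minkowski) = 0"
proof -
  have sq: "lorentz v v = - r" if "cl v * cl v = of_real r" for v :: "'n minkowski" and r
  proof -
    have "of_real (- lorentz v v) = (of_real r :: 'n clifford)"
      using cl_square[of v] that by (simp add: of_real_def)
    then show ?thesis unfolding of_real_eq_iff by simp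
  qed
  show "lorentz e0 e0 = 0" "lorentz einf einf = 0"
    using assms sq[of _ 0] by (simp_all add: pseudo_orthonormal_def)
  show "lorentz e0 einf = - 1 / 2"
    using assms clifford_relation_eq_iff[of e0 einf 1] by (simp add: pseudo_orthonormal_def)
  assume i: "i \<in> {1..CARD('n)}"
  then have "cl (e i) * cl (e i) = of_real (- 1)"
    using assms by (auto simp: pseudo_orthonormal_def minus_equation_iff[of _ 1])
  from sq[OF this] show "lorentz (e i) (e i) = 1" by simp
  show "lorentz (e i) e0 = 0" "lorentz (e i) einf = 0"
  proof -
    have "cl (e i) * cl e0 = - (cl e0 * cl (e i))" "cl (e i) * cl einf = - (cl einf * cl (e i))"
      using i assms unfolding pseudo_orthonormal_def by blast+
    then show "lorentz (e i) e0 = 0" "lorentz (e i) einf = 0"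
      using clifford_relation_eq_iff[of "e i" e0 0] clifford_relation_eq_iff[of "e i" einf 0] by simp_all
  qed
qed

section \<open>Nets generated by a spin-valued map\<close>

text \<open>From \<open>m = 3\<close> on, the induction over vertices meets pairs of directions away
  from the base vertex, where independence of the base frame says nothing directly;
  \<open>nondegenerate\<close> covers those cells.\<close>

locale spin_net =
  fixes m :: nat and \<Gamma> :: "(nat \<Rightarrow> int) set" and e0 einf :: "'n::finite minkowski"
    and e :: "nat \<Rightarrow> 'n minkowski" and \<Phi> :: "(nat \<Rightarrow> int) \<Rightarrow> 'n clifford"
    and s :: "nat \<Rightarrow> (nat \<Rightarrow> int) \<Rightarrow> 'n minkowski"
  assumes m_le: "m \<le> CARD('n)"
    and basis: "pseudo_orthonormal e0 e einf"
    and Spin: "\<And>t. t \<in> \<Gamma> \<Longrightarrow> \<Phi> t \<in> Spin"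
    and s_de_sitter: "\<And>t j. elementary_cell m \<Gamma> 1 t {j} \<Longrightarrow> s j t \<in> de_sitter"
    and \<Phi>_edge: "\<And>t j. elementary_cell m \<Gamma> 1 t {j} \<Longrightarrow>
           \<Phi> (vertex t {j}) = cl (e j) * cl (s j t) * \<Phi> t"
    and nondegenerate: "\<And>t i j. 3 \<le> m \<Longrightarrow> i \<noteq> j \<Longrightarrow> elementary_cell m \<Gamma> 2 t {i, j} \<Longrightarrow>
           s i t \<noteq> s j t \<and> s i t \<noteq> - s j t"
begin

definition net :: "'n minkowski \<Rightarrow> (nat \<Rightarrow> int) \<Rightarrow> 'n minkowski" where
  "net v t = conj_by (\<Phi> t) v"

definition frame :: "(nat \<Rightarrow> int) \<Rightarrow> nat set \<Rightarrow> 'n minkowski set" where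
  "frame t I = {e0, einf} \<union> (\<lambda>i. s i t) ` I"

text \<open>For \<open>I = {1..m}\<close> this is spanned by the vectors whose wedge is
  \<open>S\<close> at \<open>t\<close>.\<close>

definition cell_space :: "(nat \<Rightarrow> int) \<Rightarrow> nat set \<Rightarrow> 'n minkowski set" where
  "cell_space t I = span (conj_by (\<Phi> t) ` frame t I)"

lemmas e0_einf = pseudo_orthonormal_lorentz(1-3)[OF basis]

lemma e_unit: "j \<in> {1..m} \<Longrightarrow> lorentz (e j) (e j) = 1"
  using m_le by (intro pseudo_orthonormal_lorentz(4)[OF basis]) auto

lemma null_vector: "v \<in> {e0, einf} \<Longrightarrow> lorentz v v = 0"
  using e0_einf by auto

lemma reflection_e_fixes: "j \<in> {1..m} \<Longrightarrow> v \<in> {e0, einf} \<Longrightarrow> lorentz_reflection (e j) v = v"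
  using m_le pseudo_orthonormal_lorentz(5,6)[OF basis, of j]
  by (auto simp: lorentz_reflection_def)

lemma anticommute_e:
  assumes "i \<in> {1..m}" "j \<in> {1..m}" "i \<noteq> j"
  shows "cl (e i) * cl (e j) = - (cl (e j) * cl (e i))"
proof -
  have "i \<in> {1..CARD('n)}" "j \<in> {1..CARD('n)}" using assms m_le by auto
  then show ?thesis using basis assms(3) unfolding pseudo_orthonormal_def by blast
qed

lemma edge_iff: "elementary_cell m \<Gamma> 1 t {j} \<longleftrightarrow> j \<in> {1..m} \<and> t \<in> \<Gamma> \<and> vertex t {j} \<in> \<Gamma>"
  by (auto simp: elementary_cell_def cell_def Pow_insert)

lemma edge_in_cell: "j \<in> I \<Longrightarrow> I \<subseteq> {1..m} \<Longrightarrow> cell t I \<subseteq> \<Gamma> \<Longrightarrow> elementary_cell m \<Gamma> 1 t {j}"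
  using cell_mono[of "{j}" I t] by (auto simp: elementary_cell_def)

lemma base_in_cell: "cell t I \<subseteq> \<Gamma> \<Longrightarrow> t \<in> \<Gamma>"
  using cell_mono[of "{}" I t] by (auto simp: cell_def)

lemma edge_in_square:
  assumes "cell t {i, j} \<subseteq> \<Gamma>" "i \<in> {1..m}" "j \<in> {1..m}" "i \<noteq> j"
  shows "elementary_cell m \<Gamma> 1 t {i}" "elementary_cell m \<Gamma> 1 (vertex t {i}) {j}"
proof -
  show "elementary_cell m \<Gamma> 1 t {i}" using assms by (intro edge_in_cell) auto
  show "elementary_cell m \<Gamma> 1 (vertex t {i}) {j}"
    using assms cell_vertex_subset[of i "{i, j}" t]
    by (intro edge_in_cell[of _ "{i, j} - {i}"]) auto
qed

lemma s_unit: "elementary_cell m \<Gamma> 1 t {j} \<Longrightarrow> lorentz (s j t) (s j t) = 1"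
  using s_de_sitter by (simp add: de_sitter_def)

section \<open>Edges and squares of the nets\<close>

lemma conj_by_edge:
  assumes "elementary_cell m \<Gamma> 1 t {j}"
  shows "conj_by (\<Phi> (vertex t {j})) v
    = conj_by (\<Phi> t) (lorentz_reflection (s j t) (lorentz_reflection (e j) v))"
proof -
  have "\<Phi> t \<in> Spin" "\<Phi> (vertex t {j}) \<in> Spin" "j \<in> {1..m}"
    using assms[unfolded edge_iff] Spin by auto
  then show ?thesis
    unfolding \<Phi>_edge[OF assms] using e_unit s_unit[OF assms] by (intro conj_by_step) auto
qed

lemma net_edge:
  assumes "elementary_cell m \<Gamma> 1 t {j}" "v \<in> {e0, einf}"
  shows "net v (vertex t {j}) = conj_by (\<Phi> t) (lorentz_reflection (s j t) v)"
  using conj_by_edge[OF assms(1)] reflection_e_fixes[OF _ assms(2)] assms(1)[unfolded edge_iff]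
  by (simp add: net_def)

lemma square_relation:
  assumes "cell t {i, j} \<subseteq> \<Gamma>" "i \<in> {1..m}" "j \<in> {1..m}" "i \<noteq> j"
  shows "cl (lorentz_reflection (e i) (s j (vertex t {i}))) * cl (s i t)
    = - (cl (lorentz_reflection (e j) (s i (vertex t {j}))) * cl (s j t))"
proof (rule commute_relation)
  show "cl (e i) * cl (e j) = - (cl (e j) * cl (e i))" using assms by (intro anticommute_e)
  show "lorentz (e i) (e i) = 1" "lorentz (e j) (e j) = 1" using assms by (simp_all add: e_unit)
  have "cell t {j, i} \<subseteq> \<Gamma>" using assms(1) by (simp add: insert_commute)
  note ij = edge_in_square[OF assms] and ji = edge_in_square[OF this assms(3,2) assms(4)[symmetric]]
  have \<Phi>t: "\<Phi> t * clifford_inv (\<Phi> t) = 1"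
    using assms(1) by (intro Spin_inverse Spin base_in_cell)
  \<comment> \<open>The two routes to the far vertex give two values of \<open>\<Phi>\<close> there;
    the invertible \<open>\<Phi> t\<close> is then cancelled.\<close>
  have "vertex (vertex t {i}) {j} = vertex (vertex t {j}) {i}"
    using assms(4) by (simp add: vertex_vertex insert_commute)
  then have "cl (e j) * cl (s j (vertex t {i})) * (cl (e i) * cl (s i t) * \<Phi> t)
      = cl (e i) * cl (s i (vertex t {j})) * (cl (e j) * cl (s j t) * \<Phi> t)"
    using \<Phi>_edge[OF ij(2)] \<Phi>_edge[OF ji(2)] unfolding \<Phi>_edge[OF ij(1)] \<Phi>_edge[OF ji(1)] by simp
  then have "cl (e j) * cl (s j (vertex t {i})) * cl (e i) * cl (s i t) * (\<Phi> t * clifford_inv (\<Phi> t))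
      = cl (e i) * cl (s i (vertex t {j})) * cl (e j) * cl (s j t) * (\<Phi> t * clifford_inv (\<Phi> t))"
    by (simp flip: mult.assoc)
  then show "cl (e j) * cl (s j (vertex t {i})) * cl (e i) * cl (s i t)
      = cl (e i) * cl (s i (vertex t {j})) * cl (e j) * cl (s j t)"
    by (simp add: \<Phi>t)
qed

text \<open>The reflection in \<open>e i\<close> is carried inwards until it meets \<open>v\<close>,
  which it fixes. All data then refer to the frame at \<open>t\<close>.\<close>

lemma net_square:
  assumes "cell t {i, j} \<subseteq> \<Gamma>" "i \<in> {1..m}" "j \<in> {1..m}" "i \<noteq> j" and v: "v \<in> {e0, einf}"
  shows "net v (vertex t {i, j}) = conj_by (\<Phi> t) (lorentz_reflection (s i t)
    (lorentz_reflection (lorentz_reflection (e i) (s j (vertex t {i}))) v))"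
proof -
  note ij = edge_in_square[OF assms(1-4)]
  have "net v (vertex t {i, j}) = net v (vertex (vertex t {i}) {j})"
    using assms(4) by (simp add: vertex_vertex)
  also have "\<dots> = conj_by (\<Phi> t) (lorentz_reflection (s i t)
      (lorentz_reflection (e i) (lorentz_reflection (s j (vertex t {i})) v)))"
    unfolding net_edge[OF ij(2) v] conj_by_edge[OF ij(1)] ..
  finally show ?thesis
    using assms by (simp add: lorentz_reflection_conj e_unit reflection_e_fixes)
qed

lemma curvature_line_net_net:
  assumes v: "v \<in> {e0, einf}"
  shows "curvature_line_net m \<Gamma> (net v)"
  unfolding curvature_line_net_def
proof (intro allI impI)
  fix t i j assume "i \<noteq> j \<and> elementary_cell m \<Gamma> 2 t {i, j}"
  then have c: "cell t {i, j} \<subseteq> \<Gamma>" "i \<in> {1..m}" "j \<in> {1..m}" "i \<noteq> j"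
    by (auto simp: elementary_cell_def)
  then have c': "cell t {j, i} \<subseteq> \<Gamma>" by (simp add: insert_commute)
  note ij = edge_in_square[OF c] and ji = edge_in_square[OF c' c(3) c(2) c(4)[symmetric]]
  show "cross_ratio (net v t) (net v (vertex t {i})) (net v (vertex t {i, j})) (net v (vertex t {j})) \<in> \<real>"
    unfolding net_square[OF c v] net_edge[OF ij(1) v] net_edge[OF ji(1) v] net_def[of v t]
  proof (rule cross_ratio_closed_quad[OF square_relation[OF c]])
    show "\<Phi> t \<in> Spin" using c(1) by (intro Spin base_in_cell)
  qed (use c ij ji v in \<open>simp_all only: lorentz_reflection_unit e_unit s_unit null_vector\<close>)
qed

text \<open>The reflection in \<open>s j t\<close> preserves the span of the frame. It remains to
  place the reflections in \<open>e j\<close> of the face's frame vectors there, which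
  \<open>square_relation\<close> does.\<close>

lemma cell_space_step:
  assumes j: "j \<in> I" and I: "I \<subseteq> {1..m}" and c: "cell t I \<subseteq> \<Gamma>"
    and ne: "\<And>i. i \<in> I - {j} \<Longrightarrow> s i t \<noteq> s j t \<and> s i t \<noteq> - s j t"
  shows "cell_space (vertex t {j}) (I - {j}) \<subseteq> cell_space t I"
proof -
  have edge: "elementary_cell m \<Gamma> 1 t {j}" using assms by (intro edge_in_cell)
  have sj: "s j t \<in> span (frame t I)" using j by (auto simp: frame_def intro: span_base)
  have "lorentz_reflection (e j) v \<in> span (frame t I)" if v: "v \<in> frame (vertex t {j}) (I - {j})" for v
  proof (cases "v \<in> {e0, einf}")
    case True
    then show ?thesis using j I reflection_e_fixes[of j v] by (auto simp: frame_def intro!: span_base)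
  next
    case False
    then obtain i where i: "i \<in> I" "i \<noteq> j" and v_eq: "v = s i (vertex t {j})"
      using v by (auto simp: frame_def)
    then have c': "cell t {j, i} \<subseteq> \<Gamma>" "j \<in> {1..m}" "i \<in> {1..m}" "j \<noteq> i"
      using cell_mono[of "{j, i}" I t] c j I by auto
    have ni: "s j t \<noteq> s i t" "s j t \<noteq> - s i t" using ne[of i] i by auto
    have "elementary_cell m \<Gamma> 1 t {i}" using i I c by (intro edge_in_cell)
    then have "lorentz_reflection (e j) v \<in> span {s j t, s i t}"
      unfolding v_eq by (intro mem_span_if_products_opposite[OF square_relation[OF c']] s_unit edge ni)
    also have "\<dots> \<subseteq> span (frame t I)"
      using i j by (intro span_mono) (auto simp: frame_def)
    finally show ?thesis .
  qed
  then have "conj_by (\<Phi> (vertex t {j})) v \<in> conj_by (\<Phi> t) ` span (frame t I)"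
    if "v \<in> frame (vertex t {j}) (I - {j})" for v
    unfolding conj_by_edge[OF edge] using that sj by (auto intro!: lorentz_reflection_in_span)
  then show ?thesis
    unfolding cell_space_def
    using linear_span_image[OF linear_conj_by[OF Spin[OF base_in_cell[OF c]]], of "frame t I"]
    by (intro span_minimal subspace_span) auto
qed

text \<open>Induction with \<open>t\<close> and \<open>I\<close> general: after the step along
  \<open>j\<close> the remaining directions stay in the face at \<open>vertex t {j}\<close>, whose
  space is contained in that of the cell.\<close>

lemma net_in_cell_space:
  assumes "finite J" "J \<subseteq> I" "I \<subseteq> {1..m}" "cell t I \<subseteq> \<Gamma>" and v: "v \<in> {e0, einf}"
    and "3 \<le> m \<or> (\<forall>i\<in>I. \<forall>j\<in>I. i \<noteq> j \<longrightarrow> s i t \<noteq> s j t \<and> s i t \<noteq> - s j t)"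
  shows "net v (vertex t J) \<in> cell_space t I"
  using assms(1-4,6)
proof (induction J arbitrary: t I rule: finite_induct)
  case empty
  show ?case using v by (auto simp: net_def cell_space_def frame_def intro: span_base)
next
  case (insert j J)
  then have j: "j \<in> I" by simp
  have ne: "s i t \<noteq> s j t \<and> s i t \<noteq> - s j t" if "i \<in> I - {j}" for i
  proof (cases "3 \<le> m")
    case True
    have "elementary_cell m \<Gamma> 2 t {i, j}"
      using that j insert.prems cell_mono[of "{i, j}" I t] by (auto simp: elementary_cell_def)
    then show ?thesis using nondegenerate[OF True, of i j t] that by auto
  qed (use insert.prems that j in auto)
  have "net v (vertex (vertex t {j}) J) \<in> cell_space (vertex t {j}) (I - {j})"
  proof (rule insert.IH)
    show "J \<subseteq> I - {j}" "I - {j} \<subseteq> {1..m}" using insert by auto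
    show "cell (vertex t {j}) (I - {j}) \<subseteq> \<Gamma>"
      using cell_vertex_subset[OF j] insert.prems(3) by blast
    \<comment> \<open>Two directions left besides \<open>j\<close> make three, so
      \<open>nondegenerate\<close> applies at the new vertex.\<close>
    have "3 \<le> m" if "i \<in> I - {j}" "i' \<in> I - {j}" "i \<noteq> i'" for i i'
    proof -
      have "{i, i', j} \<subseteq> {1..m}" using that j insert.prems(2) by auto
      then have "card {i, i', j} \<le> m" using card_mono[of "{1..m}"] by simp
      then show ?thesis using that by simp
    qed
    then show "3 \<le> m \<or> (\<forall>i\<in>I - {j}. \<forall>i'\<in>I - {j}. i \<noteq> i' \<longrightarrow>
        s i (vertex t {j}) \<noteq> s i' (vertex t {j}) \<and> s i (vertex t {j}) \<noteq> - s i' (vertex t {j}))"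
      by blast
  qed
  then show ?case
    using cell_space_step[OF j insert.prems(2,3) ne] insert.hyps by (auto simp: vertex_vertex)
qed

section \<open>Spheres through the cells\<close>

lemma net_null:
  assumes "t \<in> \<Gamma>" "v \<in> {e0, einf}"
  shows "net v t \<in> light_cone" "net v t \<noteq> 0" "cl (net v t) = clifford_inv (\<Phi> t) * cl v * \<Phi> t"
  using assms e0_einf by (auto simp: net_def light_cone_def Spin Spin_conj null_vector)

lemma cells_on_points_in:
  assumes "subspace U" "c \<subseteq> \<Gamma>" "\<And>u v. u \<in> c \<Longrightarrow> v \<in> {e0, einf} \<Longrightarrow> net v u \<in> U"
  shows "cells_on (net e0) (net einf) c (points_in U)"
  using assms net_null by (auto simp: cells_on_def points_in_iff subset_eq)

lemma timelike_in_span: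
  assumes "t \<in> \<Gamma>" "{e0, einf} \<subseteq> A"
  shows "\<exists>v\<in>span (conj_by (\<Phi> t) ` A). lorentz v v < 0"
proof
  \<comment> \<open>Two null vectors with product -1/2 have a sum of square -1.\<close>
  show "conj_by (\<Phi> t) e0 + conj_by (\<Phi> t) einf \<in> span (conj_by (\<Phi> t) ` A)"
    using assms(2) by (intro span_add span_base) auto
  show "lorentz (conj_by (\<Phi> t) e0 + conj_by (\<Phi> t) einf) (conj_by (\<Phi> t) e0 + conj_by (\<Phi> t) einf) < 0"
    using e0_einf lorentz_commute[of einf e0] Spin[OF assms(1)] by simp
qed

text \<open>A nonzero wedge makes the transported frame independent. This yields both the sphere and
  the distinctness that starts the induction over vertices.\<close>

lemma congruence_sphere:
  assumes cell: "elementary_cell m \<Gamma> m t {1..m}"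
    and ne: "clifford_inv (\<Phi> t) * wedge (e0 # map (\<lambda>j. s j t) [1..<Suc m] @ [einf]) * \<Phi> t \<noteq> 0"
      (is "?S \<noteq> 0")
  shows "\<exists>Q. represents_sphere m ?S Q \<and> cells_on (net e0) (net einf) (cell t {1..m}) Q"
proof -
  have c: "cell t {1..m} \<subseteq> \<Gamma>" and t: "t \<in> \<Gamma>"
    using cell base_in_cell by (auto simp: elementary_cell_def)
  note lin = linear_conj_by[OF Spin[OF t]]
  define vs where "vs = map (conj_by (\<Phi> t)) (e0 # map (\<lambda>j. s j t) [1..<Suc m] @ [einf])"
  have S: "?S = wedge vs" unfolding vs_def by (rule wedge_conj_by[OF Spin[OF t], symmetric])
  have "set [1..<Suc m] = {1..m}" by auto
  then have set_vs: "set vs = conj_by (\<Phi> t) ` frame t {1..m}"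
    unfolding vs_def frame_def by auto
  have indep: "distinct vs" "independent (set vs)"
    using wedge_nonzero_independent ne unfolding S by blast+
  have sphere: "represents_sphere m ?S (points_in (span (set vs)))"
  proof -
    obtain v where "v \<in> span (set vs)" "lorentz v v < 0"
      unfolding set_vs using timelike_in_span[OF t, of "frame t {1..m}"] by (auto simp: frame_def)
    then show ?thesis
      using ne unfolding S by (intro represents_sphere_wedge) (auto simp: vs_def)
  qed
  \<comment> \<open>Equality is excluded by distinctness of the list, opposite vectors by
    independence.\<close>
  have pairs: "s i t \<noteq> s j t \<and> s i t \<noteq> - s j t" if ij: "i \<in> {1..m}" "j \<in> {1..m}" "i \<noteq> j" for i j
  proof -
    have "distinct (map (\<lambda>j. conj_by (\<Phi> t) (s j t)) [1..<Suc m])"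
      using indep(1) unfolding vs_def by (simp add: o_def del: upt_Suc)
    then have "inj_on (\<lambda>j. conj_by (\<Phi> t) (s j t)) (set [1..<Suc m])"
      by (rule distinct_map[THEN iffD1, THEN conjunct2])
    moreover have "i \<in> set [1..<Suc m]" "j \<in> set [1..<Suc m]" using ij(1,2) by auto
    ultimately have ne: "conj_by (\<Phi> t) (s i t) \<noteq> conj_by (\<Phi> t) (s j t)"
      using ij(3) inj_on_eq_iff by fastforce
    have "conj_by (\<Phi> t) (s j t) \<in> set vs - {conj_by (\<Phi> t) (s i t)}"
      using ne ij unfolding set_vs frame_def by auto
    then have "- conj_by (\<Phi> t) (s j t) \<in> span (set vs - {conj_by (\<Phi> t) (s i t)})"
      by (intro span_neg span_base)
    moreover have "conj_by (\<Phi> t) (s i t) \<notin> span (set vs - {conj_by (\<Phi> t) (s i t)})"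
      using indep(2) ij unfolding dependent_def set_vs frame_def by blast
    ultimately have "conj_by (\<Phi> t) (s i t) \<noteq> conj_by (\<Phi> t) (- s j t)"
      by (metis linear_neg[OF lin])
    then show ?thesis using ne by auto
  qed
  have "cells_on (net e0) (net einf) (cell t {1..m}) (points_in (span (set vs)))"
  proof (rule cells_on_points_in)
    fix u v assume "u \<in> cell t {1..m}" and v: "v \<in> {e0, einf}"
    then obtain J where J: "J \<subseteq> {1..m}" "u = vertex t J" by (auto simp: cell_def)
    show "net v u \<in> span (set vs)"
      unfolding J(2) set_vs cell_space_def[symmetric]
      using J(1) c v pairs by (intro net_in_cell_space) (auto intro: finite_subset)
  qed (use c in auto)
  then show ?thesis using sphere by blast
qed

text \<open>Where two hyperspheres at the base vertex coincide, which can only happen for \<open>m = 2\<close>, the frame is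
  completed by a hypersphere of the opposite edge instead.\<close>

lemma cell_in_span:
  assumes cell: "elementary_cell m \<Gamma> k t I"
  shows "\<exists>A. finite A \<and> card A \<le> k + 2 \<and> {e0, einf} \<subseteq> A \<and>
    (\<forall>u\<in>cell t I. \<forall>v\<in>{e0, einf}. net v u \<in> span (conj_by (\<Phi> t) ` A))"
proof (cases "3 \<le> m \<or> (\<forall>i\<in>I. \<forall>j\<in>I. i \<noteq> j \<longrightarrow> s i t \<noteq> s j t \<and> s i t \<noteq> - s j t)")
  case True
  have I: "I \<subseteq> {1..m}" "card I = k" "cell t I \<subseteq> \<Gamma>" "finite I"
    using cell by (auto simp: elementary_cell_def intro: finite_subset)
  have "card (frame t I) \<le> card {e0, einf} + card ((\<lambda>i. s i t) ` I)"
    unfolding frame_def by (rule card_Un_le)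
  also have "\<dots> \<le> 2 + k"
    using card_image_le[OF I(4), of "\<lambda>i. s i t"] I(2)
    by (intro add_mono) (auto intro: order.trans[OF card_insert_le_m1])
  finally have card: "card (frame t I) \<le> k + 2" by simp
  have "net v u \<in> span (conj_by (\<Phi> t) ` frame t I)" if u: "u \<in> cell t I" and "v \<in> {e0, einf}" for u v
  proof -
    obtain J where J: "J \<subseteq> I" "u = vertex t J" using u by (auto simp: cell_def)
    then show ?thesis
      unfolding cell_space_def[symmetric] J(2)
      using I True that(2) finite_subset[OF J(1) I(4)] by (intro net_in_cell_space) auto
  qed
  then show ?thesis
    using card I(4) by (intro exI[of _ "frame t I"]) (auto simp: frame_def)
next
  case False
  then obtain i j where ij: "i \<in> I" "j \<in> I" "i \<noteq> j" "s i t = s j t \<or> s i t = - s j t" and m: "m \<le> 2"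
    by force
  have I: "I \<subseteq> {1..m}" "card I = k" "cell t I \<subseteq> \<Gamma>"
    using cell by (auto simp: elementary_cell_def)
  \<comment> \<open>With at most two directions available, the cell is a square using all of
    them.\<close>
  have "card {1..m} \<le> card {i, j}" using m ij by simp
  then have "{i, j} = {1..m}" using ij I(1) by (intro card_seteq) auto
  then have Iij: "I = {j, i}" using ij I(1) by auto
  then have c: "cell t {j, i} \<subseteq> \<Gamma>" "j \<in> {1..m}" "i \<in> {1..m}" "j \<noteq> i" and k: "k = 2"
    using I ij by auto
  \<comment> \<open>By \<open>net_square\<close> the far vertex needs only reflections in
    \<open>s j t\<close> and \<open>\<sigma>\<close>; since \<open>s i t\<close> is
    \<open>s j t\<close> up to sign, \<open>\<sigma>\<close> takes its place among the four
    vectors.\<close>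
  define \<sigma> where "\<sigma> = lorentz_reflection (e j) (s i (vertex t {j}))"
  define A where "A = {e0, einf, s j t, \<sigma>}"
  note lin = linear_conj_by[OF Spin[OF base_in_cell[OF c(1)]]]
  have edges: "elementary_cell m \<Gamma> 1 t {j}" "elementary_cell m \<Gamma> 1 t {i}"
    by (rule edge_in_cell[OF _ I(1,3)], fact ij)+
  have sj: "s j t \<in> span A" and \<sigma>: "\<sigma> \<in> span A" by (simp_all add: A_def span_base)
  have si: "s i t \<in> span A" using ij(4) sj by (auto intro: span_neg)
  have "net v u \<in> span (conj_by (\<Phi> t) ` A)" if u: "u \<in> cell t I" and v: "v \<in> {e0, einf}" for u v
  proof -
    have vA: "v \<in> span A" using v by (auto simp: A_def intro: span_base)
    have "cell t I = {t, vertex t {j}, vertex t {i}, vertex t {j, i}}"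
      unfolding Iij cell_def Pow_insert Pow_empty image_insert image_empty image_Un vertex_empty by blast
    then consider "u = t" | "u = vertex t {j}" | "u = vertex t {i}" | "u = vertex t {j, i}"
      using u by blast
    then have "net v u \<in> conj_by (\<Phi> t) ` span A"
    proof cases
      case 1
      then show ?thesis using vA by (simp add: net_def)
    next
      case 2
      then show ?thesis
        using vA sj by (simp only: net_edge[OF edges(1) v]) (intro imageI lorentz_reflection_in_span)
    next
      case 3
      then show ?thesis
        using vA si by (simp only: net_edge[OF edges(2) v]) (intro imageI lorentz_reflection_in_span)
    next
      case 4
      then show ?thesis
        using vA sj \<sigma> by (simp only: net_square[OF c v] flip: \<sigma>_def) (intro imageI lorentz_reflection_in_span)
    qed
    then show ?thesis by (simp add: linear_span_image[OF lin])
  qed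
  moreover have "card A \<le> k + 2"
    unfolding A_def k by (simp add: card_insert_if)
  ultimately show ?thesis by (intro exI[of _ A]) (auto simp: A_def)
qed

lemma ribaucour_pair_net: "ribaucour_pair m \<Gamma> (net e0) (net einf)"
  unfolding ribaucour_pair_def
proof (intro conjI allI impI)
  fix k t I assume *: "1 \<le> k \<and> k \<le> m \<and> elementary_cell m \<Gamma> k t I"
  then have c: "cell t I \<subseteq> \<Gamma>" by (simp add: elementary_cell_def)
  obtain A where A: "finite A" "card A \<le> k + 2" "{e0, einf} \<subseteq> A"
      "\<forall>u\<in>cell t I. \<forall>v\<in>{e0, einf}. net v u \<in> span (conj_by (\<Phi> t) ` A)"
    using cell_in_span[of k t I] * by (elim conjE) blast
  obtain v where v: "v \<in> span (conj_by (\<Phi> t) ` A)" "lorentz v v < 0"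
    using timelike_in_span[OF base_in_cell[OF c] A(3)] by blast
  have "card (conj_by (\<Phi> t) ` A) \<le> k + 2"
    using card_image_le[OF A(1), of "conj_by (\<Phi> t)"] A(2) by simp
  \<comment> \<open>The span may have dimension below \<open>k + 2\<close>; any larger subspace of
    that dimension still contains the timelike vector.\<close>
  then obtain U where U: "subspace U" "span (conj_by (\<Phi> t) ` A) \<subseteq> U" "is_sphere k (points_in U)"
    using exists_sphere_containing[OF finite_imageI[OF A(1)] _ _ v] * m_le by (meson order.trans)
  then have "cells_on (net e0) (net einf) (cell t I) (points_in U)"
    using A(4) c by (intro cells_on_points_in) auto
  then show "\<exists>Q. is_sphere k Q \<and> cells_on (net e0) (net einf) (cell t I) Q"
    using U(3) by blast
next
  fix t j Q
  assume *: "elementary_cell m \<Gamma> 1 t {j} \<and> is_sphere 1 Q \<and> cells_on (net e0) (net einf) (cell t {j}) Q"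
  then have edge: "elementary_cell m \<Gamma> 1 t {j}" and t: "\<Phi> t \<in> Spin"
    using Spin unfolding edge_iff by auto
  obtain U where "subspace U" "Q = points_in U"
    using * by (auto simp: is_sphere_def represents_sphere_def)
  \<comment> \<open>The edge acts on both nets as the reflection in the transported
    \<open>s j t\<close>. \<open>net_def\<close> is unfolded only after \<open>net_edge\<close> has
    rewritten the far ends.\<close>
  then show "\<not> separate_on Q (point (net e0 t)) (point (net e0 (vertex t {j})))
      (point (net einf t)) (point (net einf (vertex t {j})))"
    using t e0_einf s_unit[OF edge]
    by (simp add: net_edge[OF edge] conj_by_reflection) (simp add: net_def not_separate_reflected)
qed

end

text \<open>Only a nonzero wedge represents a sphere, hence the domain chosen for \<open>S\<close>;
  the timelike vector comes from \<open>e0\<close> and \<open>einf\<close>.\<close>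

theorem mainTheorem2:
  fixes m :: nat
    and \<Gamma> :: "(nat \<Rightarrow> int) set"
    and e0 einf :: "'n::finite minkowski"
    and e :: "nat \<Rightarrow> 'n minkowski"
    and \<Phi> :: "(nat \<Rightarrow> int) \<Rightarrow> 'n clifford"
    and s :: "nat \<Rightarrow> (nat \<Rightarrow> int) \<Rightarrow> 'n minkowski"
    and F Fh :: "(nat \<Rightarrow> int) \<Rightarrow> 'n minkowski"
    and S :: "(nat \<Rightarrow> int) \<Rightarrow> 'n clifford"
  assumes "m \<le> CARD('n)"
    and "\<Gamma> \<subseteq> int_lattice m"
    and "pseudo_orthonormal e0 e einf"
    and "\<And>t. t \<in> \<Gamma> \<Longrightarrow> \<Phi> t \<in> Spin"
    (* s j t is the value of s_j at the edge from t to t + t_j *)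
    and "\<And>t j. elementary_cell m \<Gamma> 1 t {j} \<Longrightarrow> s j t \<in> de_sitter"
    and "\<And>t j. elementary_cell m \<Gamma> 1 t {j} \<Longrightarrow>
           \<Phi> (vertex t {j}) = cl (e j) * cl (s j t) * \<Phi> t"
    (* nondegeneracy, needed from m = 3 on: at each elementary 2-cell the hyperspheres
       s_i and s_j are distinct *)
    and "\<And>t i j. 3 \<le> m \<Longrightarrow> i \<noteq> j \<Longrightarrow> elementary_cell m \<Gamma> 2 t {i, j} \<Longrightarrow>
           s i t \<noteq> s j t \<and> s i t \<noteq> - s j t"
    and "F = (\<lambda>t. grade_one (clifford_inv (\<Phi> t) * cl e0 * \<Phi> t))"
    and "Fh = (\<lambda>t. grade_one (clifford_inv (\<Phi> t) * cl einf * \<Phi> t))"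
    and "S = (\<lambda>t. clifford_inv (\<Phi> t)
                    * wedge (e0 # map (\<lambda>j. s j t) [1..<Suc m] @ [einf]) * \<Phi> t)"
  shows "(\<forall>t\<in>\<Gamma>. cl (F t) = clifford_inv (\<Phi> t) * cl e0 * \<Phi> t \<and> F t \<in> light_cone - {0} \<and>
                cl (Fh t) = clifford_inv (\<Phi> t) * cl einf * \<Phi> t \<and> Fh t \<in> light_cone - {0}) \<and>
         ribaucour_congruence m \<Gamma> {t. elementary_cell m \<Gamma> m t {1..m} \<and> S t \<noteq> 0} S F Fh \<and>
         ribaucour_pair m \<Gamma> F Fh"
proof -
  interpret spin_net m \<Gamma> e0 einf e \<Phi> s
    by unfold_locales (fact assms)+
  have F: "F = net e0" and Fh: "Fh = net einf"
    unfolding assms(8,9) net_def[abs_def] conj_by_def by (rule refl)+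
  have "ribaucour_congruence m \<Gamma> {t. elementary_cell m \<Gamma> m t {1..m} \<and> S t \<noteq> 0} S F Fh"
    unfolding ribaucour_congruence_def F Fh assms(10)
    using curvature_line_net_net congruence_sphere by blast
  then show ?thesis
    using net_null ribaucour_pair_net unfolding F Fh by blast
qed

end
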